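(* Consider the dual Koopman system on $\mathbb H^2(\mathbb D^n)$ $$\dot f(t)=A_F^*f(t),\quad f(0)=k_{\mathbf x_0},\qquad \mathbf y(t)=C_hf(t),$$ associated with $\dot{\mathbf x}=F(\mathbf x)$, $\mathbf x(0)=\mathbf x_0$, $\mathbf y=h(\mathbf x)$, where Assumptions 1–5 (listed in the context) hold. If, for all principal eigenfunctions $\psi_j$ ($j\in\{1,\dots,n\}$) of the operator $A_F^*$, i.e. such that $A_F^*\psi_j=\overline{\lambda_j}\psi_j$, there exists $i\in\{1,\dots,m\}$ such that $$\langle h_i,\psi_j\rangle\neq0,$$ then the dual Koopman system is pointwise approximately observable in infinite time.
   Context: $\mathbb D^n$ is the open unit polydisc in $\mathbb C^n$, $\mathbb T^n=\{\mathbf z:|z_k|=1\ \forall k\}$, $D(\mathbf 0,R)^n=\{\mathbf z:|z_k|<R\ \forall k\}$. The Hardy space $\mathbb H^2(\mathbb D^n)$ is the Hilbert space of holomorphic $f:\mathbb D^n\to\mathbb C$ with $\|f\|^2=\lim_{r\to1^-}\int_{\mathbb T^n}|f(r\mathbf w)|^2dm_n(\mathbf w)<\infty$ ($m_n$ normalized Lebesgue measure) and inner product $\langle f,g\rangle=\sum_{\alpha\in\mathbb N^n}f_\alpha\overline{g_\alpha}$, where $f_\alpha,g_\alpha$ are Taylor coefficients at $\mathbf 0$; it is a reproducing kernel Hilbert space with reproducing functions $k_{\mathbf z_0}(\mathbf z)=\prod_{i=1}^n(1-\overline{z_{0,i}}z_i)^{-1}$. $\mathbb N$ includes $0$. Assumptions.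 1 (holomorphic flow). $F:\mathbb D^n\cup\mathbb T^n\to\mathbb C^n$ is holomorphic on $\mathbb D^n$ and continuous on $\mathbb T^n$, and generates a flow $\mathbb R^+\times\mathbb D^n\to\mathbb D^n$, $(t,\mathbf z)\mapsto\varphi^t(\mathbf z)$, which for all $t\geqslant0$ is holomorphic on $\mathbb D^n$. 2 (forward invariance). For all $t>0$ there is $R_t\in(0,1)$ such that $\varphi^t(\mathbf z)\in D(\mathbf 0,R_t)^n$ for all $\mathbf z\in\mathbb T^n$ (the flow being extended continuously to $\mathbb T^n$). 3 (stable hyperbolic equilibrium). The dynamics admits a stable equilibrium at the origin, whose basin of attraction contains $\overline{\mathbb D^n}$. The eigenvalues $\lambda_1,\dots,\lambda_n$ of the Jacobian matrix $\mathcal J_F(\mathbf 0)$ are simple and satisfy $\mathrm{Re}(\lambda_j)<0$. 4 (non-resonance). For all $(m_1,\dots,m_n)\in\mathbb N^n$ with $\sum_lm_l\geqslant2$, $\lambda_j\neq\sum_lm_l\lambda_l$ for all $j=1,\dots,n$. 5 (output map). The components $h_1,\dots,h_m$ of $h$ belong to $\mathbb H^2(\mathbb D^n)$. $K(t)f=f\circ\varphi^t$, a bounded operator on $\mathbb H^2(\mathbb D^n)$ with adjoint $K(t)^*$; $K(t)^*k_{\mathbf z}=k_{\varphi^t(\mathbf z)}$. $A_Ff=F\cdot\nabla f$ with $D(A_F)=\{f\in\mathbb H^2(\mathbb D^n):F\cdot\nabla f\in\mathbb H^2(\mathbb D^n)\}$, and $A_F^*$ is its adjoint (both closed, densely defined).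 $C_hg=(\langle g,h_1\rangle,\dots,\langle g,h_m\rangle)^T$. The principal eigenfunctions $\psi_j$ of $A_F^*$ are the eigenfunctions for the eigenvalues $\overline{\lambda_j}$, $j=1,\dots,n$. For $\tau>0$ let $\mathcal C^\tau:\mathbb H^2(\mathbb D^n)\to L^2([0,\tau],\mathbb C^m)$, $f\mapsto C_hK(\cdot)^*f$, and $\mathcal K=\{k_{\mathbf z}-k_{\mathbf z'}:\mathbf z,\mathbf z'\in\mathbb D^n\}$. The dual Koopman system is pointwise approximately observable in infinite time if $\bigcap_{\tau>0}\ker\mathcal C^\tau|_{\mathcal K}=\{0\}$, i.e. the only element of $\mathcal K$ annihilated by all $\mathcal C^\tau$, $\tau>0$, is $0$. *)

theory Defs
  imports "HOL-Analysis.Analysis"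
begin

definition polydisc :: "real \<Rightarrow> (complex ^ 'n) set" where
  "polydisc R = {z. \<forall>k. cmod (z $ k) < R}"

abbreviation unit_polydisc :: "(complex ^ 'n) set" where
  "unit_polydisc \<equiv> polydisc 1"

definition torus :: "(complex ^ 'n) set" where
  "torus = {z. \<forall>k. cmod (z $ k) = 1}"

text \<open>The normalized Lebesgue measure on the torus, carried by the Borel sets of the ambient
  space: the image of the uniform distribution of the angles.\<close>
definition torus_measure :: "(complex ^ 'n) measure" where
  "torus_measure = distr (uniform_measure lborel (cbox 0 (\<chi> i. 2 * pi) :: (real ^ 'n) set)) borel
     (\<lambda>\<theta>. \<chi> i. cis (\<theta> $ i))"

definition holomorphic_scalar :: "(complex ^ 'n \<Rightarrow> complex) \<Rightarrow> (complex ^ 'n) set \<Rightarrow> bool" where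
  "holomorphic_scalar f S \<longleftrightarrow>
     (\<forall>z\<in>S. \<exists>f'. (f has_derivative f') (at z) \<and> (\<forall>c v. f' (c *s v) = c * f' v))"

definition holomorphic_vector ::
    "(complex ^ 'n \<Rightarrow> complex ^ 'k) \<Rightarrow> (complex ^ 'n) set \<Rightarrow> bool" where
  "holomorphic_vector G S \<longleftrightarrow> (\<forall>k. holomorphic_scalar (\<lambda>z. G z $ k) S)"


subsection \<open>The Hardy space\<close>

text \<open>A function on the open unit polydisc is represented by its extension by \<open>0\<close> to the whole
  space, so that equality of elements of the Hardy space is equality of functions. The integral
  means are nondecreasing in \<open>r\<close>; hence their limit is finite iff it exists as a real number.\<close>
definition hardy :: "(complex ^ 'n \<Rightarrow> complex) set" where
  "hardy = {f. holomorphic_scalar f unit_polydisc \<and> (\<forall>z. z \<notin> unit_polydisc \<longrightarrow> f z = 0) \<and>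
     (\<exists>L::real. ((\<lambda>r. \<integral>w. (cmod (f (r *\<^sub>R w)))\<^sup>2 \<partial>torus_measure) \<longlongrightarrow> L) (at_left 1))}"

definition taylor_coeff :: "(complex ^ 'n \<Rightarrow> complex) \<Rightarrow> ('n \<Rightarrow> nat) \<Rightarrow> complex" where
  "taylor_coeff f = (THE a. \<forall>z\<in>unit_polydisc.
     ((\<lambda>\<alpha>. a \<alpha> * (\<Prod>i\<in>UNIV. z $ i ^ \<alpha> i)) has_sum f z) UNIV)"

definition hardy_inner :: "(complex ^ 'n \<Rightarrow> complex) \<Rightarrow> (complex ^ 'n \<Rightarrow> complex) \<Rightarrow> complex" where
  "hardy_inner f g = (\<Sum>\<^sub>\<infinity>\<alpha>. taylor_coeff f \<alpha> * cnj (taylor_coeff g \<alpha>))"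

definition hardy_kernel :: "complex ^ 'n \<Rightarrow> complex ^ 'n \<Rightarrow> complex" where
  "hardy_kernel z0 z =
     (if z \<in> unit_polydisc then \<Prod>i\<in>UNIV. inverse (1 - cnj (z0 $ i) * z $ i) else 0)"

text \<open>The adjoint of an operator \<open>T\<close> on the Hardy space with dense domain \<open>D\<close>.\<close>
definition adjoint_domain ::
    "(complex ^ 'n \<Rightarrow> complex) set \<Rightarrow>
     ((complex ^ 'n \<Rightarrow> complex) \<Rightarrow> complex ^ 'n \<Rightarrow> complex) \<Rightarrow> (complex ^ 'n \<Rightarrow> complex) set" where
  "adjoint_domain D T =
     {g \<in> hardy. \<exists>g'\<in>hardy. \<forall>u\<in>D. hardy_inner (T u) g = hardy_inner u g'}"

definition adjoint_op ::
    "(complex ^ 'n \<Rightarrow> complex) set \<Rightarrow>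
     ((complex ^ 'n \<Rightarrow> complex) \<Rightarrow> complex ^ 'n \<Rightarrow> complex) \<Rightarrow>
     (complex ^ 'n \<Rightarrow> complex) \<Rightarrow> complex ^ 'n \<Rightarrow> complex" where
  "adjoint_op D T g =
     (THE g'. g' \<in> hardy \<and> (\<forall>u\<in>D. hardy_inner (T u) g = hardy_inner u g'))"


subsection \<open>Koopman operators and their generator\<close>

definition koopman ::
    "(real \<Rightarrow> complex ^ 'n \<Rightarrow> complex ^ 'n) \<Rightarrow> real \<Rightarrow>
     (complex ^ 'n \<Rightarrow> complex) \<Rightarrow> complex ^ 'n \<Rightarrow> complex" where
  "koopman \<phi> t f z = (if z \<in> unit_polydisc then f (\<phi> t z) else 0)"

definition koopman_adjoint ::
    "(real \<Rightarrow> complex ^ 'n \<Rightarrow> complex ^ 'n) \<Rightarrow> real \<Rightarrow>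
     (complex ^ 'n \<Rightarrow> complex) \<Rightarrow> complex ^ 'n \<Rightarrow> complex" where
  "koopman_adjoint \<phi> t = adjoint_op hardy (koopman \<phi> t)"

definition partial_deriv :: "'n \<Rightarrow> (complex ^ 'n \<Rightarrow> complex) \<Rightarrow> complex ^ 'n \<Rightarrow> complex" where
  "partial_deriv i f z = deriv (\<lambda>s. f (z + s *s axis i 1)) 0"

definition generator ::
    "(complex ^ 'n \<Rightarrow> complex ^ 'n) \<Rightarrow> (complex ^ 'n \<Rightarrow> complex) \<Rightarrow> complex ^ 'n \<Rightarrow> complex" where
  "generator F f z =
     (if z \<in> unit_polydisc then \<Sum>i\<in>UNIV. F z $ i * partial_deriv i f z else 0)"

definition generator_domain ::
    "(complex ^ 'n \<Rightarrow> complex ^ 'n) \<Rightarrow> (complex ^ 'n \<Rightarrow> complex) set" where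
  "generator_domain F = {f \<in> hardy. generator F f \<in> hardy}"

definition generator_adjoint_domain ::
    "(complex ^ 'n \<Rightarrow> complex ^ 'n) \<Rightarrow> (complex ^ 'n \<Rightarrow> complex) set" where
  "generator_adjoint_domain F = adjoint_domain (generator_domain F) (generator F)"

definition generator_adjoint ::
    "(complex ^ 'n \<Rightarrow> complex ^ 'n) \<Rightarrow> (complex ^ 'n \<Rightarrow> complex) \<Rightarrow> complex ^ 'n \<Rightarrow> complex" where
  "generator_adjoint F = adjoint_op (generator_domain F) (generator F)"

definition adjoint_eigenfunction ::
    "(complex ^ 'n \<Rightarrow> complex ^ 'n) \<Rightarrow> complex \<Rightarrow> (complex ^ 'n \<Rightarrow> complex) \<Rightarrow> bool" where
  "adjoint_eigenfunction F \<mu> \<psi> \<longleftrightarrow>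
     \<psi> \<in> generator_adjoint_domain F \<and> \<psi> \<noteq> (\<lambda>z. 0) \<and> generator_adjoint F \<psi> = (\<lambda>z. \<mu> * \<psi> z)"


subsection \<open>Assumptions on the dynamics\<close>

definition holomorphic_flow ::
    "(complex ^ 'n \<Rightarrow> complex ^ 'n) \<Rightarrow> (real \<Rightarrow> complex ^ 'n \<Rightarrow> complex ^ 'n) \<Rightarrow> bool" where
  "holomorphic_flow F \<phi> \<longleftrightarrow>
     holomorphic_vector F unit_polydisc \<and> continuous_on (unit_polydisc \<union> torus) F \<and>
     (\<forall>t\<ge>0. \<forall>z\<in>unit_polydisc. \<phi> t z \<in> unit_polydisc) \<and>
     (\<forall>z\<in>unit_polydisc. \<phi> 0 z = z) \<and>
     (\<forall>s\<ge>0. \<forall>t\<ge>0. \<forall>z\<in>unit_polydisc. \<phi> (s + t) z = \<phi> s (\<phi> t z)) \<and>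
     (\<forall>z\<in>unit_polydisc. \<forall>t\<ge>0.
        ((\<lambda>s. \<phi> s z) has_vector_derivative F (\<phi> t z)) (at t within {0..})) \<and>
     (\<forall>t\<ge>0. holomorphic_vector (\<phi> t) unit_polydisc)"

text \<open>The values of \<open>\<phi> t\<close> are only meaningful on the open polydisc; at boundary points the flow is
  its continuous extension, i.e. the limit from inside.\<close>
definition extended_flow ::
    "(real \<Rightarrow> complex ^ 'n \<Rightarrow> complex ^ 'n) \<Rightarrow> real \<Rightarrow> complex ^ 'n \<Rightarrow> complex ^ 'n" where
  "extended_flow \<phi> t z =
     (if z \<in> unit_polydisc then \<phi> t z else Lim (at z within unit_polydisc) (\<phi> t))"

definition forward_invariant :: "(real \<Rightarrow> complex ^ 'n \<Rightarrow> complex ^ 'n) \<Rightarrow> bool" where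
  "forward_invariant \<phi> \<longleftrightarrow>
     (\<forall>t>0. continuous_on (unit_polydisc \<union> torus) (extended_flow \<phi> t) \<and>
        (\<exists>R. 0 < R \<and> R < 1 \<and> (\<forall>z\<in>torus. extended_flow \<phi> t z \<in> polydisc R)))"

definition stable_equilibrium_origin ::
    "(complex ^ 'n \<Rightarrow> complex ^ 'n) \<Rightarrow> (real \<Rightarrow> complex ^ 'n \<Rightarrow> complex ^ 'n) \<Rightarrow> bool" where
  "stable_equilibrium_origin F \<phi> \<longleftrightarrow>
     F 0 = 0 \<and>
     (\<forall>\<epsilon>>0. \<exists>\<delta>>0. \<forall>z\<in>unit_polydisc. norm z < \<delta> \<longrightarrow> (\<forall>t\<ge>0. norm (\<phi> t z) < \<epsilon>))"

definition basin_of_origin ::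
    "(real \<Rightarrow> complex ^ 'n \<Rightarrow> complex ^ 'n) \<Rightarrow> (complex ^ 'n) set" where
  "basin_of_origin \<phi> = {z \<in> closure unit_polydisc. ((\<lambda>t. extended_flow \<phi> t z) \<longlongrightarrow> 0) at_top}"

definition jacobian_matrix ::
    "(complex ^ 'n \<Rightarrow> complex ^ 'n) \<Rightarrow> complex ^ 'n \<Rightarrow> complex ^ 'n ^ 'n" where
  "jacobian_matrix F z = (\<chi> i j. partial_deriv j (\<lambda>w. F w $ i) z)"

text \<open>The family \<open>lam\<close> lists the eigenvalues of \<open>A\<close> with their algebraic multiplicities,
  so all eigenvalues are simple iff it is injective.\<close>
definition eigenvalue_family :: "complex ^ 'n ^ 'n \<Rightarrow> ('n \<Rightarrow> complex) \<Rightarrow> bool" where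
  "eigenvalue_family A lam \<longleftrightarrow> (\<forall>x. det (mat x - A) = (\<Prod>j\<in>UNIV. x - lam j))"

definition stable_hyperbolic ::
    "(complex ^ 'n \<Rightarrow> complex ^ 'n) \<Rightarrow> (real \<Rightarrow> complex ^ 'n \<Rightarrow> complex ^ 'n) \<Rightarrow>
     ('n \<Rightarrow> complex) \<Rightarrow> bool" where
  "stable_hyperbolic F \<phi> lam \<longleftrightarrow>
     stable_equilibrium_origin F \<phi> \<and>
     closure unit_polydisc \<subseteq> basin_of_origin \<phi> \<and>
     eigenvalue_family (jacobian_matrix F 0) lam \<and> inj lam \<and> (\<forall>j. Re (lam j) < 0)"

definition non_resonant :: "('n::finite \<Rightarrow> complex) \<Rightarrow> bool" where
  "non_resonant lam \<longleftrightarrow>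
     (\<forall>m :: 'n \<Rightarrow> nat. (\<Sum>l\<in>UNIV. m l) \<ge> 2 \<longrightarrow>
        (\<forall>j. lam j \<noteq> (\<Sum>l\<in>UNIV. of_nat (m l) * lam l)))"


subsection \<open>Observability of the dual Koopman system\<close>

definition output_op ::
    "(complex ^ 'n \<Rightarrow> complex ^ 'm) \<Rightarrow> (complex ^ 'n \<Rightarrow> complex) \<Rightarrow> complex ^ 'm" where
  "output_op h g = (\<chi> i. hardy_inner g (\<lambda>z. h z $ i))"

definition observation_map ::
    "(real \<Rightarrow> complex ^ 'n \<Rightarrow> complex ^ 'n) \<Rightarrow> (complex ^ 'n \<Rightarrow> complex ^ 'm) \<Rightarrow>
     (complex ^ 'n \<Rightarrow> complex) \<Rightarrow> real \<Rightarrow> complex ^ 'm" where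
  "observation_map \<phi> h f t = output_op h (koopman_adjoint \<phi> t f)"

text \<open>The observation map takes values in an \<open>L\<^sup>2\<close> space, where a function is zero iff it vanishes
  almost everywhere.\<close>
definition observation_kernel ::
    "(real \<Rightarrow> complex ^ 'n \<Rightarrow> complex ^ 'n) \<Rightarrow> (complex ^ 'n \<Rightarrow> complex ^ 'm) \<Rightarrow> real \<Rightarrow>
     (complex ^ 'n \<Rightarrow> complex) set" where
  "observation_kernel \<phi> h \<tau> =
     {f \<in> hardy. AE t in lebesgue_on {0..\<tau>}. observation_map \<phi> h f t = 0}"

definition kernel_differences :: "(complex ^ 'n \<Rightarrow> complex) set" where
  "kernel_differences =
     {(\<lambda>w. hardy_kernel z w - hardy_kernel z' w) | z z'. z \<in> unit_polydisc \<and> z' \<in> unit_polydisc}"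

definition pointwise_approx_observable ::
    "(real \<Rightarrow> complex ^ 'n \<Rightarrow> complex ^ 'n) \<Rightarrow> (complex ^ 'n \<Rightarrow> complex ^ 'm) \<Rightarrow> bool" where
  "pointwise_approx_observable \<phi> h \<longleftrightarrow>
     (\<Inter>\<tau>\<in>{0<..}. observation_kernel \<phi> h \<tau> \<inter> kernel_differences) = {\<lambda>z. 0}"

end

(* Near the attracting equilibrium two distinct trajectories x, y with the same output separate like
   solutions of the linearized system. Put w = x - y; it never vanishes by backward uniqueness. Call a
   complex linear functional l negligible if l (w t) = o(|w t|). The differential of each h_i at 0 is
   negligible, because h_i (x t) = h_i (y t), and if l is negligible then so is l o J, where J is the
   Jacobian matrix: integrate d/dt (l w) = l (J w) + o(|w|) over short time windows. A limit point of
   w / |w| lies in the common kernel of all negligible functionals, so this J-invariant subspace is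
   nonzero and contains an eigenvector v of J, on which the differentials of all h_i vanish. But
   z |-> sum_k cnj (v_k) z_k is a principal eigenfunction of the adjoint generator, and its inner
   product with h_i is the differential of h_i at 0 applied to v. *)

theory Submission
  imports Defs "HOL-Complex_Analysis.Cauchy_Integral_Formula"
begin

subsection \<open>Holomorphic functions on the polydisc\<close>

text \<open>Adjoint Koopman operators move reproducing kernels along the flow, so a difference of
  two kernels is annihilated by all observation maps exactly when the outputs along the two
  trajectories agree. This turns the question into one about pairs of trajectories.
  \<open>taylor_coeff\<close> and \<open>adjoint_op\<close> are definite descriptions and have no
  usable value before existence and uniqueness are known. Hence the Taylor expansion on the whole
  polydisc is built from an iterated Cauchy formula, and adjoints are pinned down by testing on
  monomials, whose inner products read off coefficients. On the dynamical side, the direction of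
  \<open>w\<close> need not converge: eigenvalues with equal real parts can make it rotate.
  Negligible functionals form an invariant family whatever the decay rate is, and a single limit
  point of the direction makes their common kernel nonzero. The linearization has to be an estimate
  for pairs of points, because the distance of \<open>x\<close> and \<open>y\<close> may be far
  smaller than their norms; Cauchy estimates provide it as strict differentiability at 0.\<close>

lemma norm_vector_scalar_mult: "norm (c *s v) = cmod c * norm (v :: complex ^ 'n)"
  by (simp add: norm_vec_def norm_mult L2_set_right_distrib)

lemma bounded_linear_vector_scalar_mult: "bounded_linear (\<lambda>c. c *s (v :: complex ^ 'n))"
  by (rule bounded_linear_intro[where K = "norm v"])
    (auto simp: vec_eq_iff algebra_simps norm_vector_scalar_mult)

lemmas continuous_on_vector_scalar_mult [continuous_intros] =
  bounded_linear.continuous_on[OF bounded_linear_vector_scalar_mult]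

lemma open_polydisc: "open (polydisc R :: (complex ^ 'n) set)"
proof -
  have "polydisc R = (\<Inter>k. {z :: complex ^ 'n. cmod (z $ k) < R})"
    by (auto simp: polydisc_def)
  moreover have "open {z :: complex ^ 'n. cmod (z $ k) < R}" for k
    by (intro open_Collect_less continuous_intros)
  ultimately show ?thesis
    by auto
qed

lemma convex_polydisc: "convex (polydisc R :: (complex ^ 'n) set)"
proof -
  have "polydisc R = (\<Inter>k. (\<lambda>z :: complex ^ 'n. z $ k) -` ball 0 R)"
    by (auto simp: polydisc_def dist_norm)
  moreover have "convex ((\<lambda>z :: complex ^ 'n. z $ k) -` ball 0 R)" for k
    by (intro convex_linear_vimage convex_ball bounded_linear.linear bounded_linear_vec_nth)
  ultimately show ?thesis
    by (simp add: convex_INT)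
qed

lemma polydisc_mono: "r \<le> R \<Longrightarrow> polydisc r \<subseteq> polydisc R"
  by (auto simp: polydisc_def intro: less_le_trans)

lemma zero_in_polydisc [simp]: "0 \<in> polydisc R \<longleftrightarrow> 0 < R"
  by (simp add: polydisc_def)

lemma ball_subset_polydisc: "ball 0 R \<subseteq> (polydisc R :: (complex ^ 'n) set)"
  by (auto simp: polydisc_def intro: le_less_trans[OF Finite_Cartesian_Product.norm_nth_le])

definition closed_polydisc :: "real \<Rightarrow> (complex ^ 'n) set" where
  "closed_polydisc R = {z. \<forall>k. cmod (z $ k) \<le> R}"

lemma compact_closed_polydisc: "compact (closed_polydisc R :: (complex ^ 'n) set)"
proof -
  have "closed_polydisc R = (\<Inter>k. {z :: complex ^ 'n. cmod (z $ k) \<le> R})"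
    by (auto simp: closed_polydisc_def)
  moreover have "closed {z :: complex ^ 'n. cmod (z $ k) \<le> R}" for k
    by (intro closed_Collect_le continuous_intros)
  ultimately have "closed (closed_polydisc R :: (complex ^ 'n) set)"
    by auto
  moreover have "bounded (closed_polydisc R :: (complex ^ 'n) set)"
  proof (rule boundedI)
    fix z :: "complex ^ 'n"
    assume "z \<in> closed_polydisc R"
    then have "(\<Sum>k\<in>UNIV. cmod (z $ k)) \<le> (\<Sum>k\<in>(UNIV :: 'n set). R)"
      by (intro sum_mono) (auto simp: closed_polydisc_def)
    then show "norm z \<le> (\<Sum>k\<in>(UNIV :: 'n set). R)"
      using L2_set_le_sum[of UNIV "\<lambda>k. cmod (z $ k)"] by (simp add: norm_vec_def)
  qed
  ultimately show ?thesis
    by (simp add: compact_eq_bounded_closed)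
qed

lemma polydisc_subset_closed_polydisc: "polydisc R \<subseteq> closed_polydisc R"
  by (auto simp: polydisc_def closed_polydisc_def less_imp_le)

lemma closed_polydisc_subset_polydisc: "R < R' \<Longrightarrow> closed_polydisc R \<subseteq> polydisc R'"
  by (auto simp: polydisc_def closed_polydisc_def intro: le_less_trans)

lemma compact_subset_unit_polydisc:
  fixes K :: "(complex ^ 'n) set"
  assumes "compact K" "K \<subseteq> unit_polydisc"
  obtains R where "0 < R" "R < 1" "K \<subseteq> polydisc R"
proof (cases "K = {}")
  case True
  then show ?thesis
    using that[of "1/2"] by auto
next
  case False
  have "\<exists>b<1. \<forall>z\<in>K. cmod (z $ k) \<le> b" for k
  proof -
    have "continuous_on K (\<lambda>z. cmod (z $ k))"
      by (intro continuous_intros)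
    then obtain x where "x \<in> K" "\<forall>z\<in>K. cmod (z $ k) \<le> cmod (x $ k)"
      using continuous_attains_sup[OF assms(1) False] by blast
    then show ?thesis
      using assms(2) by (auto simp: polydisc_def)
  qed
  then obtain b where b: "\<And>k. b k < 1" "\<And>k z. z \<in> K \<Longrightarrow> cmod (z $ k) \<le> b k"
    by metis
  define B where "B = max 0 (Max (range b))"
  have B: "B < 1" "0 \<le> B" "\<And>k. b k \<le> B"
    using b(1) by (auto simp: B_def le_max_iff_disj)
  show ?thesis
  proof
    \<comment> \<open>The midpoint between \<open>B\<close> and 1 turns the weak bounds by
      \<open>B\<close> into strict ones and stays below 1.\<close>
    show "0 < (B + 1) / 2" "(B + 1) / 2 < 1"
      using B by auto
    show "K \<subseteq> polydisc ((B + 1) / 2)"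
    proof
      fix z assume "z \<in> K"
      then have "cmod (z $ k) \<le> B" for k
        using b(2)[of z k] B(3)[of k] by linarith
      then show "z \<in> polydisc ((B + 1) / 2)"
        using B(1) by (auto simp: polydisc_def) (smt (verit) field_sum_of_halves)
    qed
  qed
qed

section \<open>Complex derivatives, restriction to complex lines, closure properties\<close>

lemma holomorphic_scalar_imp_continuous_on:
  assumes "holomorphic_scalar f S"
  shows "continuous_on S f"
  using assms has_derivative_continuous
  by (fastforce simp: holomorphic_scalar_def intro!: continuous_at_imp_continuous_on)

text \<open>\<open>holomorphic_scalar\<close> only provides some complex homogeneous derivative;
  uniqueness of derivatives identifies it with \<open>frechet_derivative\<close>, which thus
  inherits the homogeneity.\<close>

lemma holomorphic_scalar_frechet:
  assumes "holomorphic_scalar f S" "z \<in> S"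
  shows "(f has_derivative frechet_derivative f (at z)) (at z)"
    and "frechet_derivative f (at z) (c *s v) = c * frechet_derivative f (at z) v"
proof -
  obtain f' where f': "(f has_derivative f') (at z)" "\<forall>c v. f' (c *s v) = c * f' v"
    using assms by (auto simp: holomorphic_scalar_def)
  then have "frechet_derivative f (at z) = f'"
    using frechet_derivative_at by metis
  then show "(f has_derivative frechet_derivative f (at z)) (at z)"
    and "frechet_derivative f (at z) (c *s v) = c * frechet_derivative f (at z) v"
    using f' by auto
qed

text \<open>The chain rule along a complex line reduces several variables to one, where Cauchy's
  formula and Cauchy's inequality are available.\<close>

lemma holomorphic_scalar_line_deriv:
  fixes f :: "complex ^ 'n \<Rightarrow> complex"
  assumes "holomorphic_scalar f S" "z + s *s v \<in> S"
  shows "((\<lambda>s. f (z + s *s v)) has_field_derivative frechet_derivative f (at (z + s *s v)) v) (at s)"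
proof -
  note D = holomorphic_scalar_frechet[OF assms]
  have line: "((\<lambda>s. z + s *s v) has_derivative (\<lambda>c. c *s v)) (at s)"
    by (auto intro!: derivative_eq_intros
        bounded_linear.has_derivative[OF bounded_linear_vector_scalar_mult])
  have "((\<lambda>s. f (z + s *s v)) has_derivative
      (\<lambda>c. frechet_derivative f (at (z + s *s v)) (c *s v))) (at s)"
    using has_derivative_compose[OF line D(1)] by (simp add: o_def)
  then show ?thesis
    by (simp add: D(2) has_field_derivative_def mult_commute_abs)
qed

lemma partial_deriv_eq_frechet:
  assumes "holomorphic_scalar f S" "z \<in> S"
  shows "partial_deriv i f z = frechet_derivative f (at z) (axis i 1)"
  unfolding partial_deriv_def
  using holomorphic_scalar_line_deriv[of f S z 0 "axis i 1"] assms
  by (intro DERIV_imp_deriv) simp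

lemma frechet_eq_sum_partial_deriv:
  assumes "holomorphic_scalar f S" "z \<in> S"
  shows "frechet_derivative f (at z) v = (\<Sum>i\<in>UNIV. v $ i * partial_deriv i f z)"
proof -
  note D = holomorphic_scalar_frechet[OF assms]
  have "v = (\<Sum>i\<in>UNIV. (v $ i) *s axis i 1)"
    by (simp add: basis_expansion)
  then have "frechet_derivative f (at z) v
      = (\<Sum>i\<in>UNIV. frechet_derivative f (at z) ((v $ i) *s axis i 1))"
    using linear_sum[OF has_derivative_linear[OF D(1)]] by metis
  then show ?thesis
    by (simp add: D(2) partial_deriv_eq_frechet[OF assms])
qed

lemma holomorphic_scalar_const [simp]: "holomorphic_scalar (\<lambda>z. c) S"
  unfolding holomorphic_scalar_def by (auto intro!: exI[of _ "\<lambda>v. 0"])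

lemma holomorphic_scalar_nth: "holomorphic_scalar (\<lambda>z. z $ i) S"
  unfolding holomorphic_scalar_def
  by (auto intro!: exI[of _ "\<lambda>v. v $ i"] bounded_linear_imp_has_derivative bounded_linear_vec_nth)

lemma holomorphic_scalar_add:
  assumes "holomorphic_scalar f S" "holomorphic_scalar g S"
  shows "holomorphic_scalar (\<lambda>z. f z + g z) S"
  unfolding holomorphic_scalar_def
proof
  fix z assume "z \<in> S"
  with assms obtain f' g' where "(f has_derivative f') (at z)" "\<forall>c v. f' (c *s v) = c * f' v"
    "(g has_derivative g') (at z)" "\<forall>c v. g' (c *s v) = c * g' v"
    unfolding holomorphic_scalar_def by blast
  then show "\<exists>h'. ((\<lambda>z. f z + g z) has_derivative h') (at z) \<and> (\<forall>c v. h' (c *s v) = c * h' v)"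
    by (intro exI[of _ "\<lambda>v. f' v + g' v"]) (auto intro: has_derivative_add simp: algebra_simps)
qed

lemma holomorphic_scalar_mult:
  assumes "holomorphic_scalar f S" "holomorphic_scalar g S"
  shows "holomorphic_scalar (\<lambda>z. f z * g z) S"
  unfolding holomorphic_scalar_def
proof
  fix z assume "z \<in> S"
  with assms obtain f' g' where "(f has_derivative f') (at z)" "\<forall>c v. f' (c *s v) = c * f' v"
    "(g has_derivative g') (at z)" "\<forall>c v. g' (c *s v) = c * g' v"
    unfolding holomorphic_scalar_def by blast
  then show "\<exists>h'. ((\<lambda>z. f z * g z) has_derivative h') (at z) \<and> (\<forall>c v. h' (c *s v) = c * h' v)"
    by (intro exI[of _ "\<lambda>v. f z * g' v + f' v * g z"])
      (auto intro: has_derivative_mult simp: algebra_simps)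
qed

lemma holomorphic_scalar_sum:
  "(\<And>i. i \<in> I \<Longrightarrow> holomorphic_scalar (f i) S) \<Longrightarrow> holomorphic_scalar (\<lambda>z. \<Sum>i\<in>I. f i z) S"
  by (induction I rule: infinite_finite_induct) (auto intro: holomorphic_scalar_add)

lemma holomorphic_scalar_prod:
  "(\<And>i. i \<in> I \<Longrightarrow> holomorphic_scalar (f i) S) \<Longrightarrow> holomorphic_scalar (\<lambda>z. \<Prod>i\<in>I. f i z) S"
  by (induction I rule: infinite_finite_induct) (auto intro: holomorphic_scalar_mult)

lemma holomorphic_scalar_cmult:
  "holomorphic_scalar f S \<Longrightarrow> holomorphic_scalar (\<lambda>z. c * f z) S"
  by (intro holomorphic_scalar_mult holomorphic_scalar_const)

lemma holomorphic_scalar_diff: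
  "holomorphic_scalar f S \<Longrightarrow> holomorphic_scalar g S \<Longrightarrow> holomorphic_scalar (\<lambda>z. f z - g z) S"
  using holomorphic_scalar_add[of f S "\<lambda>z. (-1) * g z"] holomorphic_scalar_cmult[of g S "-1"]
  by simp

lemma holomorphic_scalar_power:
  "holomorphic_scalar f S \<Longrightarrow> holomorphic_scalar (\<lambda>z. f z ^ n) S"
  by (induction n) (auto intro: holomorphic_scalar_mult)

lemma holomorphic_scalar_compose_field:
  assumes "holomorphic_scalar f S" "\<And>z. z \<in> S \<Longrightarrow> (g has_field_derivative g' z) (at (f z))"
  shows "holomorphic_scalar (\<lambda>z. g (f z)) S"
  unfolding holomorphic_scalar_def
proof
  fix z assume z: "z \<in> S"
  with assms obtain f' where f': "(f has_derivative f') (at z)" "\<forall>c v. f' (c *s v) = c * f' v"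
    unfolding holomorphic_scalar_def by blast
  show "\<exists>h'. ((\<lambda>z. g (f z)) has_derivative h') (at z) \<and> (\<forall>c v. h' (c *s v) = c * h' v)"
    using has_derivative_compose[OF f'(1) assms(2)[OF z, unfolded has_field_derivative_def]] f'(2)
    by (intro exI[of _ "\<lambda>v. g' z * f' v"]) auto
qed

lemma holomorphic_scalar_compose:
  fixes G :: "complex ^ 'n \<Rightarrow> complex ^ 'k"
  assumes f: "holomorphic_scalar f T" and G: "holomorphic_vector G S"
    and GST: "\<And>z. z \<in> S \<Longrightarrow> G z \<in> T"
  shows "holomorphic_scalar (\<lambda>z. f (G z)) S"
  unfolding holomorphic_scalar_def
proof
  fix z assume z: "z \<in> S"
  have "\<forall>k. \<exists>g'. ((\<lambda>z. G z $ k) has_derivative g') (at z) \<and> (\<forall>c v. g' (c *s v) = c * g' v)"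
    using G z unfolding holomorphic_vector_def holomorphic_scalar_def by blast
  then obtain g' where g': "\<And>k. ((\<lambda>z. G z $ k) has_derivative g' k) (at z)"
      "\<And>k c v. g' k (c *s v) = c * g' k v"
    by metis
  obtain f' where f': "(f has_derivative f') (at (G z))" "\<forall>c v. f' (c *s v) = c * f' v"
    using f GST[OF z] unfolding holomorphic_scalar_def by blast
  \<comment> \<open>Expanding \<open>G\<close> in the standard basis assembles the coordinate
    derivatives into a derivative of the vector-valued map.\<close>
  have "((\<lambda>z. \<Sum>k\<in>UNIV. (G z $ k) *s axis k 1) has_derivative
      (\<lambda>v. \<Sum>k\<in>UNIV. ((\<chi> k. g' k v) $ k) *s axis k 1)) (at z)"
    using g'(1)
    by (auto intro!: has_derivative_sum
        bounded_linear.has_derivative[OF bounded_linear_vector_scalar_mult])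
  then have G': "(G has_derivative (\<lambda>v. \<chi> k. g' k v)) (at z)"
    by (simp only: basis_expansion)
  moreover have "(\<chi> k. g' k (c *s v)) = c *s (\<chi> k. g' k v)" for c v
    by (simp add: vec_eq_iff g'(2))
  ultimately show "\<exists>h'. ((\<lambda>z. f (G z)) has_derivative h') (at z) \<and> (\<forall>c v. h' (c *s v) = c * h' v)"
    using has_derivative_compose[OF G' f'(1)] f'(2)
    by (intro exI[of _ "\<lambda>v. f' (\<chi> k. g' k v)"]) auto
qed

lemma holomorphic_scalar_cong:
  assumes "open S" "\<And>z. z \<in> S \<Longrightarrow> f z = g z"
  shows "holomorphic_scalar f S \<longleftrightarrow> holomorphic_scalar g S"
  using has_derivative_transform_within_open[OF _ assms(1)] assms(2)
  unfolding holomorphic_scalar_def by (metis (no_types, lifting))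

subsection \<open>Cauchy's formula and Taylor expansion on the polydisc\<close>

text \<open>The normalized uniform measure of a single angle. Its finite products carry the Cauchy
  integrals, because a product measure can be integrated one coordinate at a time.\<close>

definition angle_measure :: "real measure" where
  "angle_measure = uniform_measure lborel {0..2 * pi}"

lemma sets_angle_measure [measurable_cong, simp]: "sets angle_measure = sets borel"
  by (simp add: angle_measure_def)

lemma space_angle_measure [simp]: "space angle_measure = UNIV"
  by (simp add: angle_measure_def)

lemma emeasure_angle_measure_UNIV: "emeasure angle_measure UNIV = 1"
  by (simp add: angle_measure_def emeasure_uniform_measure_1)

lemma product_sigma_finite_angle: "product_sigma_finite (\<lambda>_. angle_measure)"
proof -
  interpret finite_measure angle_measure
    by standard (simp add: emeasure_angle_measure_UNIV)
  show ?thesis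
    by standard
qed

lemma finite_measure_PiM_angle:
  assumes "finite I"
  shows "finite_measure (Pi\<^sub>M I (\<lambda>_. angle_measure))"
    and "measure (Pi\<^sub>M I (\<lambda>_. angle_measure)) (space (Pi\<^sub>M I (\<lambda>_. angle_measure))) = 1"
proof -
  interpret product_sigma_finite "\<lambda>_. angle_measure"
    by (rule product_sigma_finite_angle)
  have *: "emeasure (Pi\<^sub>M I (\<lambda>_. angle_measure)) (space (Pi\<^sub>M I (\<lambda>_. angle_measure))) = 1"
    using emeasure_PiM[of I "\<lambda>_. UNIV"] assms
    by (simp add: space_PiM emeasure_angle_measure_UNIV)
  show "finite_measure (Pi\<^sub>M I (\<lambda>_. angle_measure))"
    by standard (simp add: *)
  show "measure (Pi\<^sub>M I (\<lambda>_. angle_measure)) (space (Pi\<^sub>M I (\<lambda>_. angle_measure))) = 1"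
    by (simp add: * measure_def)
qed

lemma integrable_angle_measure:
  fixes g :: "real \<Rightarrow> complex"
  assumes "continuous_on UNIV g"
  shows "integrable angle_measure g"
    and "(\<integral>t. g t \<partial>angle_measure) = integral {0..2 * pi} g / (2 * pi)"
proof -
  have [measurable]: "g \<in> borel_measurable borel"
    using assms by (rule borel_measurable_continuous_onI)
  have "1 / ennreal (2 * pi) = ennreal (1 / (2 * pi))"
    using divide_ennreal[of 1 "2 * pi"] by simp
  then have *: "angle_measure = density lborel (\<lambda>t. ennreal (indicator {0..2 * pi} t / (2 * pi)))"
    unfolding angle_measure_def uniform_measure_def
    by (intro arg_cong2[where f = density] refl ext) (auto split: split_indicator)
  have "continuous_on {0..2 * pi} g"
    using assms continuous_on_subset by blast
  then have int: "set_integrable lborel {0..2 * pi} g"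
    by (rule borel_integrable_atLeastAtMost')
  have eq: "(indicator {0..2 * pi} t / (2 * pi)) *\<^sub>R g t = (indicator {0..2 * pi} t *\<^sub>R g t) / (2 * pi)" for t
    by (simp add: scaleR_conv_of_real)
  show "integrable angle_measure g"
    using int unfolding * set_integrable_def
    by (subst integrable_density) (auto simp: eq)
  have "(\<integral>t. g t \<partial>angle_measure) = (\<integral>t. (indicator {0..2 * pi} t *\<^sub>R g t) / (2 * pi) \<partial>lborel)"
    unfolding * by (subst integral_density) (auto simp: eq)
  also have "\<dots> = (\<integral>t. indicator {0..2 * pi} t *\<^sub>R g t \<partial>lborel) / (2 * pi)"
    by simp
  also have "\<dots> = integral {0..2 * pi} g / (2 * pi)"
    using set_borel_integral_eq_integral(2)[OF int] by (simp add: set_lebesgue_integral_def)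
  finally show "(\<integral>t. g t \<partial>angle_measure) = integral {0..2 * pi} g / (2 * pi)" .
qed

section \<open>Termwise integration, geometric series, orthogonality of characters\<close>

text \<open>The sum runs along the net of finite subsets of the index set, so instead of a theorem
  about sequences the Weierstrass M-test is used: the partial sums converge uniformly, and a finite
  measure lets the integral pass to the limit.\<close>

lemma has_sum_integral_of_bounded:
  fixes g :: "'a \<Rightarrow> 'b \<Rightarrow> complex"
  assumes "finite_measure M"
    and [measurable]: "\<And>i. g i \<in> borel_measurable M"
    and bound: "\<And>i x. x \<in> space M \<Longrightarrow> norm (g i x) \<le> B i"
    and summable: "B summable_on UNIV"
    and G: "\<And>x. x \<in> space M \<Longrightarrow> ((\<lambda>i. g i x) has_sum G x) UNIV"
    and [measurable]: "G \<in> borel_measurable M"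
  shows "((\<lambda>i. \<integral>x. g i x \<partial>M) has_sum (\<integral>x. G x \<partial>M)) UNIV"
proof -
  interpret finite_measure M by fact
  have int_g: "integrable M (g i)" for i
    by (rule integrable_const_bound[where B = "B i"]) (auto simp: bound intro!: AE_I2)
  have unif: "uniform_limit (space M) (\<lambda>I x. \<Sum>i\<in>I. g i x) (\<lambda>x. \<Sum>\<^sub>\<infinity>i. g i x)
      (finite_subsets_at_top UNIV)"
    using bound summable by (intro Weierstrass_m_test_general) auto
  have int_G: "integrable M G"
  proof (rule integrable_const_bound[where B = "\<Sum>\<^sub>\<infinity>i. B i"])
    show "AE x in M. norm (G x) \<le> (\<Sum>\<^sub>\<infinity>i. B i)"
      by (intro AE_I2 norm_infsum_le[OF G has_sum_infsum[OF summable]] bound)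
  qed simp
  show ?thesis
    unfolding has_sum_def
  proof (rule tendstoI)
    fix e :: real assume e: "e > 0"
    \<comment> \<open>The \<open>+ 1\<close> keeps the denominator positive for a zero measure and
      makes the last inequality strict.\<close>
    define d where "d = e / (measure M (space M) + 1)"
    have d: "d > 0"
      using e by (simp add: d_def add_nonneg_pos)
    have "\<forall>\<^sub>F I in finite_subsets_at_top UNIV. finite I \<and>
        (\<forall>x\<in>space M. dist (\<Sum>i\<in>I. g i x) (\<Sum>\<^sub>\<infinity>i. g i x) < d)"
      using uniform_limitD[OF unif d] eventually_finite_subsets_at_top_weakI
      by (intro eventually_conj) auto
    then show "\<forall>\<^sub>F I in finite_subsets_at_top UNIV.
        dist (\<Sum>i\<in>I. \<integral>x. g i x \<partial>M) (\<integral>x. G x \<partial>M) < e"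
    proof eventually_elim
      case (elim I)
      have "dist (\<Sum>i\<in>I. \<integral>x. g i x \<partial>M) (\<integral>x. G x \<partial>M)
          = norm (\<integral>x. ((\<Sum>i\<in>I. g i x) - G x) \<partial>M)"
        using int_g int_G by (simp add: dist_norm Bochner_Integration.integral_sum)
      also have "\<dots> \<le> (\<integral>x. d \<partial>M)"
        using elim int_g int_G infsumI[OF G]
        by (intro order_trans[OF integral_norm_bound] integral_mono)
          (auto simp: dist_norm less_imp_le)
      also have "\<dots> = d * measure M (space M)"
        by simp
      also have "\<dots> < e"
      proof -
        have "d * (measure M (space M) + 1) = e"
          using measure_nonneg[of M "space M"] by (simp add: d_def add_nonneg_eq_0_iff)
        then show ?thesis
          using d by (simp add: algebra_simps)
      qed
      finally show ?case .
    qed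
  qed
qed

text \<open>A finite product of absolutely convergent geometric series, multiplied out over
  multi-indices. It expands both the Cauchy kernel and the reproducing kernel.\<close>

lemma summable_on_prod_geometric:
  fixes x :: "'n :: finite \<Rightarrow> complex"
  assumes "\<And>i. cmod (x i) < 1"
  shows "(\<lambda>\<alpha>. cmod (\<Prod>i\<in>UNIV. x i ^ \<alpha> i)) summable_on UNIV"
    and "((\<lambda>\<alpha>. \<Prod>i\<in>UNIV. x i ^ \<alpha> i) has_sum (\<Prod>i\<in>UNIV. inverse (1 - x i))) UNIV"
proof -
  have 1: "(\<lambda>m. cmod (x i ^ m)) summable_on UNIV" for i
    using assms[of i] summable_on_UNIV_nonneg_real_iff[of "\<lambda>m. cmod (x i) ^ m"]
    by (simp add: norm_power)
  have 2: "(\<Sum>\<^sub>\<infinity>m. x i ^ m) = inverse (1 - x i)" for i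
  proof -
    have "(\<lambda>m. x i ^ m) sums (1 / (1 - x i))"
      using assms[of i] by (rule geometric_sums)
    moreover have "((\<lambda>m. x i ^ m) has_sum (\<Sum>\<^sub>\<infinity>m. x i ^ m)) UNIV"
      using abs_summable_summable[OF 1] by simp
    ultimately show ?thesis
      using has_sum_imp_sums sums_unique2 by (fastforce simp: inverse_eq_divide)
  qed
  show 3: "(\<lambda>\<alpha>. cmod (\<Prod>i\<in>UNIV. x i ^ \<alpha> i)) summable_on UNIV"
    using abs_summable_on_prod_PiE[of UNIV "\<lambda>_. UNIV" "\<lambda>i m. x i ^ m"] 1
    by (simp flip: abs_summable_equivalent)
  show "((\<lambda>\<alpha>. \<Prod>i\<in>UNIV. x i ^ \<alpha> i) has_sum (\<Prod>i\<in>UNIV. inverse (1 - x i))) UNIV"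
    using infsum_prod_PiE_abs[of UNIV "\<lambda>i m. x i ^ m" "\<lambda>_. UNIV"] 1
      has_sum_infsum[OF abs_summable_summable[OF 3]]
    by (simp add: 2)
qed

lemma integral_cis_angle_measure:
  "(\<integral>t. cis t ^ a * cnj (cis t) ^ b \<partial>angle_measure) = (if a = b then 1 else 0)"
proof -
  have cont: "continuous_on UNIV (\<lambda>t. cis t ^ a * cnj (cis t) ^ b)"
    by (intro continuous_intros continuous_on_cis)
  have "(\<lambda>t. cis t ^ a * cnj (cis t) ^ b) = (\<lambda>t. cis ((real a - real b) * t))"
  proof
    fix t
    have "cnj (cis t) ^ b = cis (- (real b * t))"
      using Complex.DeMoivre[of "- t" b] by (simp add: cis_cnj)
    moreover have "cis t ^ a = cis (real a * t)"
      by (rule Complex.DeMoivre)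
    ultimately show "cis t ^ a * cnj (cis t) ^ b = cis ((real a - real b) * t)"
      by (simp only: cis_mult) (simp add: algebra_simps)
  qed
  moreover have "((\<lambda>t. cis ((real a - real b) * t)) has_integral (if a = b then 2 * pi else 0)) {0..2 * pi}"
  proof (cases "a = b")
    case True
    then show ?thesis
      using has_integral_const_real[of "1 :: complex" 0 "2 * pi"]
      by (simp add: scaleR_conv_of_real)
  next
    case False
    define m where "m = real a - real b"
    have m: "m \<noteq> 0"
      using False by (simp add: m_def)
    have "((\<lambda>t. cis (m * t)) has_integral
        (cis (m * (2 * pi)) / (\<i> * m) - cis (m * 0) / (\<i> * m))) {0..2 * pi}"
    proof (rule fundamental_theorem_of_calculus)
      fix t :: real
      have "((\<lambda>w. exp (\<i> * m * w) / (\<i> * m)) has_field_derivative exp (\<i> * m * t)) (at (of_real t))"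
        using m by (auto intro!: derivative_eq_intros)
      from has_vector_derivative_real_field[OF this]
      show "((\<lambda>t. cis (m * t) / (\<i> * m)) has_vector_derivative cis (m * t)) (at t within {0..2 * pi})"
        by (simp add: cis_conv_exp mult.assoc)
    qed simp
    \<comment> \<open>\<open>m\<close> is a nonzero integer, so the primitive takes the same value
      at both ends of the period.\<close>
    moreover have "cis (m * (2 * pi)) = 1"
    proof -
      have "cis (m * (2 * pi)) = cis (2 * pi * of_int (int a - int b))"
        by (simp add: m_def algebra_simps)
      then show ?thesis
        by (simp add: cis_multiple_2pi)
    qed
    ultimately show ?thesis
      using False by (simp add: m_def)
  qed
  ultimately show ?thesis
    using integrable_angle_measure(2)[OF cont] by (simp only: integral_unique) simp
qed

section \<open>Cauchy's formula on the circle and on the torus\<close>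

text \<open>On the circle \<open>w = R * cis t\<close> one has dw = i w dt, and w / (w - z) is the
  inverse of 1 - (z / R) * cnj (cis t). In this form the kernel is the sum of a geometric series in
  z / R, ready for expansion.\<close>

lemma Cauchy_formula_angle_measure:
  fixes g :: "complex \<Rightarrow> complex"
  assumes g: "g holomorphic_on ball 0 1" and R: "0 < R" "R < 1" and z: "cmod z < R"
  shows "g z = (\<integral>t. g (R * cis t) * inverse (1 - z / R * cnj (cis t)) \<partial>angle_measure)"
proof -
  have "g holomorphic_on cball 0 R"
    using R by (intro holomorphic_on_subset[OF g]) auto
  then have "((\<lambda>u. g u / (u - z)) has_contour_integral (2 * of_real pi * \<i> * g z)) (circlepath 0 R)"
    using z by (intro Cauchy_integral_circlepath_simple) auto
  then have 1: "((\<lambda>t. g (R * cis t) / (R * cis t - z) * R * \<i> * cis t) has_integral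
      (2 * of_real pi * \<i> * g z)) {0..2 * pi}"
    unfolding circlepath_def by (subst (asm) has_contour_integral_part_circlepath_iff) auto
  have nz: "R * cis t - z \<noteq> 0" for t
  proof
    assume "R * cis t - z = 0"
    then have "cmod (R * cis t) = cmod z"
      by simp
    then show False
      using z R by (simp add: norm_mult)
  qed
  have 2: "g (R * cis t) / (R * cis t - z) * R * \<i> * cis t
      = \<i> * (g (R * cis t) * inverse (1 - z / R * cnj (cis t)))" for t
  proof -
    have "cnj (cis t) = 1 / cis t"
      by (simp add: cis_cnj divide_inverse)
    moreover have "R * cis t \<noteq> 0"
      using R by simp
    ultimately have "1 - z / R * cnj (cis t) = (R * cis t - z) / (R * cis t)"
      by (simp add: diff_divide_distrib)
    then have "inverse (1 - z / R * cnj (cis t)) = R * cis t / (R * cis t - z)"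
      by simp
    then show ?thesis
      by simp
  qed
  have "continuous_on UNIV (\<lambda>t. g (R * cis t))"
    using R by (intro continuous_on_compose2[OF holomorphic_on_imp_continuous_on[OF g]]
      continuous_intros continuous_on_cis) (auto simp: norm_mult)
  moreover have "1 - z / R * cnj (cis t) \<noteq> 0" for t
  proof
    assume "1 - z / R * cnj (cis t) = 0"
    then have "cmod (z / R * cnj (cis t)) = 1"
      by simp
    then show False
      using z R by (simp add: norm_mult norm_divide)
  qed
  ultimately have "continuous_on UNIV (\<lambda>t. g (R * cis t) * inverse (1 - z / R * cnj (cis t)))"
    by (intro continuous_intros continuous_on_cis) auto
  note 3 = integrable_angle_measure(2)[OF this]
  have "\<i> * integral {0..2 * pi} (\<lambda>t. g (R * cis t) * inverse (1 - z / R * cnj (cis t))) = 2 * of_real pi * \<i> * g z"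
    using 1 unfolding 2 by (simp add: integral_unique flip: integral_mult_right)
  then show ?thesis
    unfolding 3 by (simp add: field_simps)
qed

lemma borel_measurable_vec_lambda:
  fixes g :: "'a \<Rightarrow> 'n :: finite \<Rightarrow> complex"
  assumes "\<And>i. (\<lambda>x. g x i) \<in> borel_measurable M"
  shows "(\<lambda>x. \<chi> i. g x i) \<in> borel_measurable M"
proof -
  have "(\<lambda>x. (g x i) *s (axis i 1 :: complex ^ 'n)) \<in> borel_measurable M" for i
    by (rule borel_measurable_continuous_on[OF linear_continuous_on assms])
      (rule bounded_linear_vector_scalar_mult)
  then have "(\<lambda>x. \<Sum>i\<in>UNIV. ((\<chi> i. g x i) $ i) *s (axis i 1 :: complex ^ 'n)) \<in> borel_measurable M"
    by (intro borel_measurable_sum) simp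
  then show ?thesis
    by (simp only: basis_expansion)
qed

lemma borel_measurable_compose_continuous_on_open:
  fixes f :: "'b :: topological_space \<Rightarrow> complex"
  assumes "continuous_on S f" "open S" "V \<in> borel_measurable M" "\<And>x. x \<in> space M \<Longrightarrow> V x \<in> S"
  shows "(\<lambda>x. f (V x)) \<in> borel_measurable M"
proof -
  have "(\<lambda>z. if z \<in> S then f z else 0) \<in> borel_measurable borel"
    using assms(1,2) by (intro borel_measurable_continuous_on_if) auto
  from measurable_compose[OF assms(3) this] show ?thesis
    by (rule measurable_cong[THEN iffD1, rotated]) (simp add: assms(4))
qed

text \<open>Integrability for Fubini: \<open>f\<close> is bounded on the compact polydisc of radius
  \<open>R\<close>, and each factor is at most 1 / (1 - |x i|) in modulus, because |cis| =
  1.\<close>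

lemma integrable_Cauchy_integrand:
  fixes f :: "complex ^ 'n \<Rightarrow> complex" and z :: "complex ^ 'n"
  assumes f: "continuous_on unit_polydisc f" and R: "0 < R" "R < 1" and z: "z \<in> polydisc R"
    and x: "\<And>i. cmod (x i) < 1"
  shows "integrable (Pi\<^sub>M S (\<lambda>_. angle_measure))
    (\<lambda>\<theta>. f (\<chi> i. if i \<in> S then R * cis (\<theta> i) else z $ i) *
        (\<Prod>i\<in>S. inverse (1 - x i * cnj (cis (\<theta> i)))))"
proof -
  interpret finite_measure "Pi\<^sub>M S (\<lambda>_. angle_measure)"
    by (rule finite_measure_PiM_angle) simp
  have V: "(\<chi> i. if i \<in> S then R * cis (\<theta> i) else z $ i) \<in> closed_polydisc R" for \<theta>
    using z R by (auto simp: closed_polydisc_def polydisc_def norm_mult less_imp_le)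
  have sub: "closed_polydisc R \<subseteq> (unit_polydisc :: (complex ^ 'n) set)"
    by (rule closed_polydisc_subset_polydisc) (rule R)
  have "compact (f ` closed_polydisc R)"
    using continuous_on_subset[OF f sub] compact_closed_polydisc by (rule compact_continuous_image)
  then obtain M where M: "\<And>z. z \<in> closed_polydisc R \<Longrightarrow> cmod (f z) \<le> M"
    by (meson bounded_iff compact_imp_bounded imageI)
  have comp: "(\<lambda>\<theta>. \<theta> i) \<in> borel_measurable (Pi\<^sub>M S (\<lambda>_. angle_measure))" if "i \<in> S" for i
    using measurable_component_singleton[OF that, of "\<lambda>_. angle_measure"]
    by (simp cong: measurable_cong_sets)
  have cis: "(\<lambda>\<theta>. cis (\<theta> i)) \<in> borel_measurable (Pi\<^sub>M S (\<lambda>_. angle_measure))" if "i \<in> S" for i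
    by (rule borel_measurable_continuous_on[OF _ comp[OF that]]) (intro continuous_intros continuous_on_cis)
  have cis': "(\<lambda>\<theta>. cnj (cis (\<theta> i))) \<in> borel_measurable (Pi\<^sub>M S (\<lambda>_. angle_measure))" if "i \<in> S" for i
    by (rule borel_measurable_continuous_on[OF _ cis[OF that]]) (intro continuous_intros)
  show ?thesis
  proof (rule integrable_const_bound)
    have "(\<lambda>\<theta>. \<chi> i. if i \<in> S then R * cis (\<theta> i) else z $ i)
        \<in> borel_measurable (Pi\<^sub>M S (\<lambda>_. angle_measure))"
    proof (rule borel_measurable_vec_lambda)
      show "(\<lambda>\<theta>. if i \<in> S then R * cis (\<theta> i) else z $ i)
          \<in> borel_measurable (Pi\<^sub>M S (\<lambda>_. angle_measure))" for i
        by (cases "i \<in> S") (auto intro: borel_measurable_times cis)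
    qed
    then have "(\<lambda>\<theta>. f (\<chi> i. if i \<in> S then R * cis (\<theta> i) else z $ i))
        \<in> borel_measurable (Pi\<^sub>M S (\<lambda>_. angle_measure))"
      using V sub
      by (intro borel_measurable_compose_continuous_on_open[OF f open_polydisc]) auto
    moreover have "(\<lambda>\<theta>. \<Prod>i\<in>S. inverse (1 - x i * cnj (cis (\<theta> i))))
        \<in> borel_measurable (Pi\<^sub>M S (\<lambda>_. angle_measure))"
      using cis' by (intro borel_measurable_prod borel_measurable_inverse borel_measurable_diff
          borel_measurable_times) auto
    ultimately show "(\<lambda>\<theta>. f (\<chi> i. if i \<in> S then R * cis (\<theta> i) else z $ i) *
        (\<Prod>i\<in>S. inverse (1 - x i * cnj (cis (\<theta> i)))))
        \<in> borel_measurable (Pi\<^sub>M S (\<lambda>_. angle_measure))"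
      by (rule borel_measurable_times)
    have "cmod (\<Prod>i\<in>S. inverse (1 - x i * cnj (cis (\<theta> i)))) \<le> (\<Prod>i\<in>S. 1 / (1 - cmod (x i)))" for \<theta>
      unfolding prod_norm[symmetric]
    proof (rule prod_mono)
      fix i
      have "1 - cmod (x i) \<le> cmod (1 - x i * cnj (cis (\<theta> i)))"
        using norm_triangle_ineq2[of 1 "x i * cnj (cis (\<theta> i))"] by (simp add: norm_mult)
      then show "0 \<le> cmod (inverse (1 - x i * cnj (cis (\<theta> i)))) \<and>
          cmod (inverse (1 - x i * cnj (cis (\<theta> i)))) \<le> 1 / (1 - cmod (x i))"
        using x[of i] by (auto simp: norm_divide inverse_eq_divide intro!: divide_left_mono mult_pos_pos)
    qed
    then show "AE \<theta> in Pi\<^sub>M S (\<lambda>_. angle_measure).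
        norm (f (\<chi> i. if i \<in> S then R * cis (\<theta> i) else z $ i) *
        (\<Prod>i\<in>S. inverse (1 - x i * cnj (cis (\<theta> i))))) \<le> M * (\<Prod>i\<in>S. 1 / (1 - cmod (x i)))"
      unfolding norm_mult using V x
      by (intro AE_I2 mult_mono M) (auto intro: order_trans[OF norm_ge_zero M])
  qed
qed

text \<open>Only the coordinates in \<open>S\<close> are integrated out; this makes induction on \<open>S\<close> possible.\<close>
lemma Cauchy_formula_polydisc_partial:
  fixes f :: "complex ^ 'n \<Rightarrow> complex"
  assumes f: "holomorphic_scalar f unit_polydisc" and R: "0 < R" "R < 1" and z: "z \<in> polydisc R"
  shows "f z = (\<integral>\<theta>. f (\<chi> i. if i \<in> S then R * cis (\<theta> i) else z $ i) *
      (\<Prod>i\<in>S. inverse (1 - z $ i / R * cnj (cis (\<theta> i)))) \<partial>Pi\<^sub>M S (\<lambda>_. angle_measure))"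
proof -
  have "finite S"
    by simp
  then show ?thesis
  proof (induction S)
    case empty
    interpret finite_measure "Pi\<^sub>M {} (\<lambda>_ :: 'n. angle_measure)"
      by (rule finite_measure_PiM_angle) simp
    show ?case
      using finite_measure_PiM_angle(2)[of "{} :: 'n set"] by simp
  next
    case (insert k S)
    interpret product_sigma_finite "\<lambda>_ :: 'n. angle_measure"
      by (rule product_sigma_finite_angle)
    define V where "V S \<theta> = (\<chi> i. if i \<in> S then R * cis (\<theta> i) else z $ i)" for S and \<theta> :: "'n \<Rightarrow> real"
    define P where "P S \<theta> = (\<Prod>i\<in>S. inverse (1 - z $ i / R * cnj (cis (\<theta> i))))" for S and \<theta> :: "'n \<Rightarrow> real"
    have "cmod (z $ i / R) < 1" for i
      using z R by (simp add: polydisc_def norm_divide)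
    then have int: "integrable (Pi\<^sub>M (insert k S) (\<lambda>_. angle_measure)) (\<lambda>\<theta>. f (V (insert k S) \<theta>) * P (insert k S) \<theta>)"
      unfolding V_def P_def using holomorphic_scalar_imp_continuous_on[OF f] R z
      by (intro integrable_Cauchy_integrand)
    have "f (V S \<theta>) * P S \<theta> = (\<integral>t. f (V (insert k S) (\<theta>(k := t))) * P (insert k S) (\<theta>(k := t)) \<partial>angle_measure)"
      for \<theta>
    proof -
      \<comment> \<open>All coordinates but the \<open>k\<close>-th are frozen, those in
        \<open>S\<close> on the circle of radius \<open>R\<close> and the others at
        \<open>z\<close>. The complex line through \<open>u\<close> in direction \<open>k\<close>
        stays in the polydisc for |s| < 1, so the one-variable formula applies.\<close>
      define u where "u = (\<chi> i. if i = k then 0 else V S \<theta> $ i)"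
      have u: "u + s *s axis k 1 \<in> unit_polydisc" if "cmod s < 1" for s
        using that z R by (auto simp: u_def V_def polydisc_def axis_def norm_mult intro: less_trans)
      define g where "g = (\<lambda>s. f (u + s *s axis k 1))"
      have "g holomorphic_on ball 0 1"
        unfolding g_def using holomorphic_scalar_line_deriv[OF f u]
        by (subst holomorphic_on_open) (auto simp: dist_norm, blast)
      moreover have "cmod (z $ k) < R"
        using z by (simp add: polydisc_def)
      ultimately have "g (z $ k) = (\<integral>t. g (R * cis t) * inverse (1 - z $ k / R * cnj (cis t)) \<partial>angle_measure)"
        using R by (intro Cauchy_formula_angle_measure)
      \<comment> \<open>As \<open>k\<close> is not in \<open>S\<close>, the \<open>k\<close>-th
        coordinate of \<open>V S \<theta>\<close> is still that of \<open>z\<close>.\<close>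
      moreover have "g (z $ k) = f (V S \<theta>)"
        using insert.hyps by (auto simp: g_def u_def V_def axis_def vec_eq_iff intro!: arg_cong[of _ _ f])
      moreover have "g (R * cis t) = f (V (insert k S) (\<theta>(k := t)))" for t
        by (auto simp: g_def u_def V_def axis_def vec_eq_iff intro!: arg_cong[of _ _ f])
      moreover have "P (insert k S) (\<theta>(k := t)) = inverse (1 - z $ k / R * cnj (cis t)) * P S \<theta>" for t
      proof -
        have "P S (\<theta>(k := t)) = P S \<theta>"
          unfolding P_def by (rule prod.cong) (use insert.hyps in auto)
        then show ?thesis
          using insert.hyps by (simp add: P_def)
      qed
      ultimately show ?thesis
        by (simp flip: mult.assoc)
    qed
    then have "f z = (\<integral>\<theta>. (\<integral>t. f (V (insert k S) (\<theta>(k := t))) * P (insert k S) (\<theta>(k := t)) \<partial>angle_measure)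
        \<partial>Pi\<^sub>M S (\<lambda>_. angle_measure))"
      using insert.IH by (simp add: V_def P_def)
    \<comment> \<open>Fubini merges the inner integral over the new angle with the integral over the
      old ones.\<close>
    also have "\<dots> = (\<integral>\<theta>. f (V (insert k S) \<theta>) * P (insert k S) \<theta> \<partial>Pi\<^sub>M (insert k S) (\<lambda>_. angle_measure))"
      using product_integral_insert[OF insert.hyps int] by simp
    finally show ?case
      by (simp only: V_def P_def)
  qed
qed

section \<open>Power series in several variables: existence, uniqueness, Taylor coefficients\<close>

abbreviation monomial :: "('n \<Rightarrow> nat) \<Rightarrow> complex ^ 'n \<Rightarrow> complex" where
  "monomial \<alpha> z \<equiv> (\<Prod>i\<in>UNIV. z $ i ^ \<alpha> i)"

text \<open>Each Cauchy factor is a geometric series; integrating the product term by term splits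
  off the monomial in \<open>z\<close> and leaves an integral that no longer contains
  \<open>z\<close>. This integral is the coefficient. It may still depend on \<open>R\<close>;
  uniqueness removes that dependence later.\<close>

lemma power_series_expansion_polydisc:
  fixes f :: "complex ^ 'n \<Rightarrow> complex"
  assumes f: "holomorphic_scalar f unit_polydisc" and R: "0 < R" "R < 1"
  shows "\<exists>a. \<forall>z\<in>polydisc R. ((\<lambda>\<alpha>. a \<alpha> * monomial \<alpha> z) has_sum f z) UNIV"
proof (intro exI ballI)
  let ?M = "Pi\<^sub>M UNIV (\<lambda>_ :: 'n. angle_measure)"
  define V where "V \<theta> = (\<chi> i. R * cis (\<theta> i))" for \<theta> :: "'n \<Rightarrow> real"
  define a where "a \<alpha> = (\<integral>\<theta>. f (V \<theta>) * (\<Prod>i\<in>UNIV. (cnj (cis (\<theta> i)) / R) ^ \<alpha> i) \<partial>?M)" for \<alpha>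
  fix z :: "complex ^ 'n"
  assume z: "z \<in> polydisc R"
  have zR: "cmod (z $ i / R) < 1" for i
    using z R by (simp add: polydisc_def norm_divide)
  have V: "V \<theta> \<in> closed_polydisc R" for \<theta>
    using R by (auto simp: closed_polydisc_def V_def norm_mult)
  have sub: "closed_polydisc R \<subseteq> (unit_polydisc :: (complex ^ 'n) set)"
    by (rule closed_polydisc_subset_polydisc) (rule R)
  have contf: "continuous_on unit_polydisc f"
    by (rule holomorphic_scalar_imp_continuous_on[OF f])
  have "compact (f ` closed_polydisc R)"
    using continuous_on_subset[OF contf sub] compact_closed_polydisc by (rule compact_continuous_image)
  then obtain M where M: "\<And>z. z \<in> closed_polydisc R \<Longrightarrow> cmod (f z) \<le> M"
    by (meson bounded_iff compact_imp_bounded imageI)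
  have [measurable]: "(\<lambda>\<theta>. cis (\<theta> i)) \<in> borel_measurable ?M" for i
    using borel_measurable_continuous_on[of cis "\<lambda>\<theta>. \<theta> i" ?M]
      measurable_component_singleton[of i UNIV "\<lambda>_. angle_measure"]
    by (simp add: continuous_on_cis cong: measurable_cong_sets)
  have [measurable]: "(\<lambda>\<theta>. cnj (cis (\<theta> i))) \<in> borel_measurable ?M" for i
    by (rule borel_measurable_continuous_on[of cnj]) (auto intro: continuous_intros)
  have [measurable]: "(\<lambda>\<theta>. f (V \<theta>)) \<in> borel_measurable ?M"
    using V sub unfolding V_def
    by (intro borel_measurable_compose_continuous_on_open[OF contf open_polydisc]
        borel_measurable_vec_lambda) auto
  have "((\<lambda>\<alpha>. \<integral>\<theta>. f (V \<theta>) * (\<Prod>i\<in>UNIV. (z $ i / R * cnj (cis (\<theta> i))) ^ \<alpha> i) \<partial>?M) has_sum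
      (\<integral>\<theta>. f (V \<theta>) * (\<Prod>i\<in>UNIV. inverse (1 - z $ i / R * cnj (cis (\<theta> i)))) \<partial>?M)) UNIV"
  proof (rule has_sum_integral_of_bounded)
    show "finite_measure ?M"
      by (rule finite_measure_PiM_angle) simp
    show "(\<lambda>\<alpha>. M * cmod (\<Prod>i\<in>UNIV. (z $ i / R) ^ \<alpha> i)) summable_on UNIV"
      by (intro summable_on_cmult_right summable_on_prod_geometric(1) zR)
    show "norm (f (V \<theta>) * (\<Prod>i\<in>UNIV. (z $ i / R * cnj (cis (\<theta> i))) ^ \<alpha> i))
        \<le> M * cmod (\<Prod>i\<in>UNIV. (z $ i / R) ^ \<alpha> i)" for \<theta> \<alpha>
    proof -
      have "cmod (\<Prod>i\<in>UNIV. (z $ i / R * cnj (cis (\<theta> i))) ^ \<alpha> i) = cmod (\<Prod>i\<in>UNIV. (z $ i / R) ^ \<alpha> i)"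
        by (simp add: norm_mult norm_power norm_divide flip: prod_norm)
      then show ?thesis
        using M[OF V] by (simp add: norm_mult mult_right_mono)
    qed
    show "((\<lambda>\<alpha>. f (V \<theta>) * (\<Prod>i\<in>UNIV. (z $ i / R * cnj (cis (\<theta> i))) ^ \<alpha> i)) has_sum
        f (V \<theta>) * (\<Prod>i\<in>UNIV. inverse (1 - z $ i / R * cnj (cis (\<theta> i))))) UNIV" for \<theta>
      using zR by (intro has_sum_cmult_right summable_on_prod_geometric(2)) (simp add: norm_mult norm_divide)
  qed measurable
  moreover have "f z = (\<integral>\<theta>. f (V \<theta>) * (\<Prod>i\<in>UNIV. inverse (1 - z $ i / R * cnj (cis (\<theta> i)))) \<partial>?M)"
    using Cauchy_formula_polydisc_partial[OF f R z, of UNIV] by (simp add: V_def)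
  moreover have "(\<integral>\<theta>. f (V \<theta>) * (\<Prod>i\<in>UNIV. (z $ i / R * cnj (cis (\<theta> i))) ^ \<alpha> i) \<partial>?M)
      = a \<alpha> * monomial \<alpha> z" for \<alpha>
  proof -
    have "f (V \<theta>) * (\<Prod>i\<in>UNIV. (z $ i / R * cnj (cis (\<theta> i))) ^ \<alpha> i)
        = f (V \<theta>) * (\<Prod>i\<in>UNIV. (cnj (cis (\<theta> i)) / R) ^ \<alpha> i) * monomial \<alpha> z" for \<theta>
      by (simp add: power_mult_distrib power_divide prod.distrib prod_dividef)
    then show ?thesis
      unfolding a_def by (simp only: integral_mult_left_zero)
  qed
  ultimately show "((\<lambda>\<alpha>. a \<alpha> * monomial \<alpha> z) has_sum f z) UNIV"
    by simp
qed

text \<open>Multiplying the series by the conjugate of the monomial with exponent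
  \<open>\<beta>\<close> and integrating over a torus of radius \<open>\<rho>\<close> kills all
  terms but the one with index \<open>\<beta>\<close>, by orthogonality of characters.\<close>

lemma power_series_polydisc_zero:
  fixes c :: "('n :: finite \<Rightarrow> nat) \<Rightarrow> complex"
  assumes r: "r > 0" and c: "\<And>z. z \<in> polydisc r \<Longrightarrow> ((\<lambda>\<alpha>. c \<alpha> * monomial \<alpha> z) has_sum 0) UNIV"
  shows "c = (\<lambda>\<alpha>. 0)"
proof
  fix \<beta>
  let ?M = "Pi\<^sub>M UNIV (\<lambda>_ :: 'n. angle_measure)"
  interpret product_sigma_finite "\<lambda>_ :: 'n. angle_measure"
    by (rule product_sigma_finite_angle)
  define \<rho> where "\<rho> = r / 2"
  have \<rho>: "0 < \<rho>" "\<rho> < r"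
    using r by (auto simp: \<rho>_def)
  have [measurable]: "(\<lambda>\<theta>. cis (\<theta> i)) \<in> borel_measurable ?M" for i
    using borel_measurable_continuous_on[of cis "\<lambda>\<theta>. \<theta> i" ?M]
      measurable_component_singleton[of i UNIV "\<lambda>_. angle_measure"]
    by (simp add: continuous_on_cis cong: measurable_cong_sets)
  have [measurable]: "(\<lambda>\<theta>. cnj (cis (\<theta> i))) \<in> borel_measurable ?M" for i
    by (rule borel_measurable_continuous_on[of cnj]) (auto intro: continuous_intros)
  define g where "g \<alpha> \<theta> = c \<alpha> * (\<Prod>i\<in>UNIV. \<rho> ^ \<alpha> i) *
      (\<Prod>i\<in>UNIV. cis (\<theta> i) ^ \<alpha> i * cnj (cis (\<theta> i)) ^ \<beta> i)" for \<alpha> and \<theta> :: "'n \<Rightarrow> real"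
  have "((\<lambda>\<alpha>. \<integral>\<theta>. g \<alpha> \<theta> \<partial>?M) has_sum (\<integral>\<theta>. 0 \<partial>?M)) UNIV"
  proof (rule has_sum_integral_of_bounded)
    show "finite_measure ?M"
      by (rule finite_measure_PiM_angle) simp
    show "g \<alpha> \<in> borel_measurable ?M" for \<alpha>
      unfolding g_def by measurable
    \<comment> \<open>Convergence at the single point with all coordinates \<open>\<rho>\<close> is
      absolute, since the sum is unordered, and so bounds the series uniformly on the whole torus of
      that radius.\<close>
    have "(\<lambda>\<alpha>. c \<alpha> * monomial \<alpha> (\<chi> i. \<rho>)) summable_on UNIV"
      using c[of "\<chi> i. \<rho>"] \<rho> by (auto simp: summable_on_def polydisc_def)
    then show "(\<lambda>\<alpha>. cmod (c \<alpha> * (\<Prod>i\<in>UNIV. \<rho> ^ \<alpha> i))) summable_on UNIV"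
      by (simp add: summable_on_iff_abs_summable_on_complex)
    show "cmod (g \<alpha> \<theta>) \<le> cmod (c \<alpha> * (\<Prod>i\<in>UNIV. \<rho> ^ \<alpha> i))" for \<alpha> \<theta>
      by (simp add: g_def norm_mult norm_power flip: prod_norm)
    show "((\<lambda>\<alpha>. g \<alpha> \<theta>) has_sum 0) UNIV" for \<theta>
    proof -
      have "(\<chi> i. \<rho> * cis (\<theta> i)) \<in> polydisc r"
        using \<rho> by (auto simp: polydisc_def norm_mult)
      from has_sum_cmult_left[OF c[OF this], of "\<Prod>i\<in>UNIV. cnj (cis (\<theta> i)) ^ \<beta> i"]
      show ?thesis
        by (simp add: g_def power_mult_distrib prod.distrib mult_ac)
    qed
  qed simp
  moreover have "(\<integral>\<theta>. g \<alpha> \<theta> \<partial>?M) = (if \<alpha> = \<beta> then c \<beta> * (\<Prod>i\<in>UNIV. \<rho> ^ \<beta> i) else 0)" for \<alpha>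
  proof -
    have "(\<integral>\<theta>. g \<alpha> \<theta> \<partial>?M) = c \<alpha> * (\<Prod>i\<in>UNIV. \<rho> ^ \<alpha> i) *
        (\<Prod>i\<in>UNIV. \<integral>t. cis t ^ \<alpha> i * cnj (cis t) ^ \<beta> i \<partial>angle_measure)"
      unfolding g_def
      by (subst product_integral_prod[symmetric])
        (auto intro!: integrable_angle_measure(1) continuous_intros continuous_on_cis)
    also have "(\<Prod>i\<in>UNIV. \<integral>t. cis t ^ \<alpha> i * cnj (cis t) ^ \<beta> i \<partial>angle_measure)
        = (if \<alpha> = \<beta> then 1 else 0)"
      by (auto simp: integral_cis_angle_measure fun_eq_iff)
    finally show ?thesis
      by simp
  qed
  ultimately have "((\<lambda>\<alpha>. if \<alpha> = \<beta> then c \<beta> * (\<Prod>i\<in>UNIV. \<rho> ^ \<beta> i) else 0) has_sum 0) UNIV"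
    by simp
  moreover have "((\<lambda>\<alpha>. if \<alpha> = \<beta> then c \<beta> * (\<Prod>i\<in>UNIV. \<rho> ^ \<beta> i) else 0) has_sum
      (c \<beta> * (\<Prod>i\<in>UNIV. \<rho> ^ \<beta> i))) UNIV"
    by (rule has_sum_finite_neutralI[where B = "{\<beta>}"]) auto
  ultimately have "c \<beta> * (\<Prod>i\<in>UNIV. \<rho> ^ \<beta> i) = 0"
    using has_sum_unique by blast
  then show "c \<beta> = 0"
    using \<rho> by auto
qed

lemma power_series_polydisc_unique:
  fixes a b :: "('n :: finite \<Rightarrow> nat) \<Rightarrow> complex"
  assumes "r > 0" "\<And>z. z \<in> polydisc r \<Longrightarrow> ((\<lambda>\<alpha>. a \<alpha> * monomial \<alpha> z) has_sum f z) UNIV"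
    "\<And>z. z \<in> polydisc r \<Longrightarrow> ((\<lambda>\<alpha>. b \<alpha> * monomial \<alpha> z) has_sum f z) UNIV"
  shows "a = b"
proof -
  have "((\<lambda>\<alpha>. (a \<alpha> - b \<alpha>) * monomial \<alpha> z) has_sum 0) UNIV" if "z \<in> polydisc r" for z
    using has_sum_add[OF assms(2)[OF that] has_sum_uminusI[OF assms(3)[OF that]]]
    by (simp add: algebra_simps)
  then have "(\<lambda>\<alpha>. a \<alpha> - b \<alpha>) = (\<lambda>\<alpha>. 0)"
    by (rule power_series_polydisc_zero[OF assms(1)])
  then show ?thesis
    by (simp add: fun_eq_iff)
qed

text \<open>The way to evaluate the definite description: exhibit any expansion valid on the open
  polydisc.\<close>

lemma taylor_coeff_unique:
  assumes "\<And>z. z \<in> unit_polydisc \<Longrightarrow> ((\<lambda>\<alpha>. a \<alpha> * monomial \<alpha> z) has_sum f z) UNIV"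
  shows "taylor_coeff f = a"
  unfolding taylor_coeff_def
  using assms power_series_polydisc_unique[of 1 _ f a] by (intro the_equality) auto

lemma has_sum_taylor_coeff:
  fixes f :: "complex ^ 'n \<Rightarrow> complex"
  assumes f: "holomorphic_scalar f unit_polydisc" and z: "z \<in> unit_polydisc"
  shows "((\<lambda>\<alpha>. taylor_coeff f \<alpha> * monomial \<alpha> z) has_sum f z) UNIV"
proof -
  obtain a where a: "\<And>R z. 0 < R \<Longrightarrow> R < 1 \<Longrightarrow> z \<in> polydisc R \<Longrightarrow>
      ((\<lambda>\<alpha>. a R \<alpha> * monomial \<alpha> z) has_sum f z) UNIV"
    using power_series_expansion_polydisc[OF f] by metis
  \<comment> \<open>The expansions for two radii agree on the smaller polydisc, so by uniqueness the
    coefficients for the arbitrary reference radius 1/2 serve for all radii.\<close>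
  have eq: "a R = a (1/2)" if "0 < R" "R < 1" for R
  proof (rule power_series_polydisc_unique[of "min R (1/2)"])
    show "((\<lambda>\<alpha>. a R \<alpha> * monomial \<alpha> z) has_sum f z) UNIV" if "z \<in> polydisc (min R (1/2))" for z
      using a[of R z] that \<open>0 < R\<close> \<open>R < 1\<close> polydisc_mono[of "min R (1/2)" R] by auto
    show "((\<lambda>\<alpha>. a (1/2) \<alpha> * monomial \<alpha> z) has_sum f z) UNIV" if "z \<in> polydisc (min R (1/2))" for z
    proof (rule a)
      have "polydisc (min R (1/2)) \<subseteq> (polydisc (1/2) :: (complex ^ 'n) set)"
        by (rule polydisc_mono) simp
      then show "z \<in> polydisc (1/2)"
        using that by blast
    qed auto
  qed (use that in auto)
  have *: "((\<lambda>\<alpha>. a (1/2) \<alpha> * monomial \<alpha> z) has_sum f z) UNIV" if "z \<in> unit_polydisc" for z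
  proof -
    have "{z} \<subseteq> unit_polydisc"
      using that by simp
    then obtain R where "0 < R" "R < 1" "z \<in> polydisc R"
      using compact_subset_unit_polydisc[of "{z}"] by auto
    then show ?thesis
      using a eq by metis
  qed
  then have "taylor_coeff f = a (1/2)"
    by (rule taylor_coeff_unique)
  then show ?thesis
    using *[OF z] by simp
qed

subsection \<open>Cauchy estimates\<close>

lemma norm_nth_le_vec: "cmod (v $ k) \<le> norm (v :: complex ^ 'n)"
  by (rule Finite_Cartesian_Product.norm_nth_le)

lemma line_in_closed_polydisc:
  assumes "z \<in> closed_polydisc R" "cmod s * norm v \<le> \<rho>"
  shows "z + s *s v \<in> closed_polydisc (R + \<rho>)"
proof -
  have "cmod ((z + s *s v) $ k) \<le> R + \<rho>" for k
  proof -
    have "cmod ((z + s *s v) $ k) \<le> cmod (z $ k) + cmod s * cmod (v $ k)"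
      using norm_triangle_ineq[of "z $ k" "s * v $ k"] by (simp add: norm_mult)
    also have "\<dots> \<le> cmod (z $ k) + cmod s * norm v"
      by (intro add_left_mono mult_left_mono norm_nth_le_vec) auto
    finally show ?thesis
      using assms(1)[unfolded closed_polydisc_def] assms(2) by (smt (verit) mem_Collect_eq)
  qed
  then show ?thesis
    by (simp add: closed_polydisc_def)
qed

text \<open>Cauchy's inequality for the restriction of \<open>f\<close> to the line through
  \<open>z\<close> in direction \<open>v\<close>. The radius \<open>\<rho> / norm v\<close> keeps
  every coordinate within \<open>R + \<rho>\<close>, and dividing by it produces the factor
  \<open>norm v\<close>.\<close>

lemma frechet_Cauchy_estimate:
  fixes f :: "complex ^ 'n \<Rightarrow> complex"
  assumes f: "holomorphic_scalar f unit_polydisc" and z: "z \<in> closed_polydisc R"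
    and \<rho>: "0 < \<rho>" "R + \<rho> < 1"
    and B: "\<And>w. w \<in> closed_polydisc (R + \<rho>) \<Longrightarrow> cmod (f w) \<le> B"
  shows "cmod (frechet_derivative f (at z) v) \<le> B / \<rho> * norm v"
proof (cases "v = 0")
  case True
  have "z \<in> unit_polydisc"
    using z \<rho> closed_polydisc_subset_polydisc[of R 1] by auto
  then show ?thesis
    using holomorphic_scalar_frechet(2)[OF f, of z 0 0] True by simp
next
  case False
  define r where "r = \<rho> / norm v"
  have r: "r > 0"
    using \<rho> False by (simp add: r_def)
  have sub: "closed_polydisc (R + \<rho>) \<subseteq> (unit_polydisc :: (complex ^ 'n) set)"
    by (rule closed_polydisc_subset_polydisc) (rule \<rho>)
  have line: "z + s *s v \<in> closed_polydisc (R + \<rho>)" if "cmod s \<le> r" for s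
    using that False by (intro line_in_closed_polydisc z) (simp add: r_def field_simps)
  have D: "((\<lambda>s. f (z + s *s v)) has_field_derivative frechet_derivative f (at (z + s *s v)) v) (at s)"
    if "cmod s \<le> r" for s
    using line[OF that] sub by (intro holomorphic_scalar_line_deriv[OF f]) auto
  have "(\<lambda>s. f (z + s *s v)) holomorphic_on cball 0 r"
    unfolding holomorphic_on_def field_differentiable_def
    using D by (meson has_field_derivative_at_within mem_cball_0)
  then have "cmod ((deriv ^^ 1) (\<lambda>s. f (z + s *s v)) 0) \<le> fact 1 * B / r ^ 1"
    using r line B
    by (intro Cauchy_inequality) (auto intro: holomorphic_on_imp_continuous_on holomorphic_on_subset)
  moreover have "deriv (\<lambda>s. f (z + s *s v)) 0 = frechet_derivative f (at z) v"
    using D[of 0] r by (auto intro: DERIV_imp_deriv)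
  ultimately show ?thesis
    by (simp add: r_def)
qed

text \<open>Cauchy's inequality for \<open>s \<mapsto> f (z + s v) - f (w + s v)\<close>: uniform continuity of \<open>f\<close> already
  yields continuity of its derivative.\<close>
lemma frechet_diff_Cauchy_estimate:
  fixes f :: "complex ^ 'n \<Rightarrow> complex"
  assumes f: "holomorphic_scalar f unit_polydisc"
    and z: "z \<in> closed_polydisc R" and w: "w \<in> closed_polydisc R" and \<rho>: "0 < \<rho>" "R + \<rho> < 1"
    and B: "\<And>u. z + u \<in> closed_polydisc (R + \<rho>) \<Longrightarrow> w + u \<in> closed_polydisc (R + \<rho>) \<Longrightarrow>
      cmod (f (z + u) - f (w + u)) \<le> B"
  shows "cmod (frechet_derivative f (at z) v - frechet_derivative f (at w) v) \<le> B / \<rho> * norm v"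
proof (cases "v = 0")
  case True
  have "z \<in> unit_polydisc" "w \<in> unit_polydisc"
    using z w \<rho> closed_polydisc_subset_polydisc[of R 1] by auto
  then show ?thesis
    using holomorphic_scalar_frechet(2)[OF f, of _ 0 0] True by simp
next
  case False
  define r where "r = \<rho> / norm v"
  have r: "r > 0"
    using \<rho> False by (simp add: r_def)
  have sub: "closed_polydisc (R + \<rho>) \<subseteq> (unit_polydisc :: (complex ^ 'n) set)"
    by (rule closed_polydisc_subset_polydisc) (rule \<rho>)
  have line: "p + s *s v \<in> closed_polydisc (R + \<rho>)" if "cmod s \<le> r" "p \<in> closed_polydisc R" for s p
    using that False by (intro line_in_closed_polydisc) (simp_all add: r_def field_simps)
  let ?g = "\<lambda>s. f (z + s *s v) - f (w + s *s v)"
  have D: "(?g has_field_derivative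
      frechet_derivative f (at (z + s *s v)) v - frechet_derivative f (at (w + s *s v)) v) (at s)"
    if "cmod s \<le> r" for s
    using line[OF that z] line[OF that w] sub
    by (intro DERIV_diff holomorphic_scalar_line_deriv[OF f]) auto
  have "?g holomorphic_on cball 0 r"
    unfolding holomorphic_on_def field_differentiable_def
    using D by (meson has_field_derivative_at_within mem_cball_0)
  then have "cmod ((deriv ^^ 1) ?g 0) \<le> fact 1 * B / r ^ 1"
    using r line[OF _ z] line[OF _ w] B
    by (intro Cauchy_inequality) (auto intro: holomorphic_on_imp_continuous_on holomorphic_on_subset)
  moreover have "deriv ?g 0 = frechet_derivative f (at z) v - frechet_derivative f (at w) v"
    using D[of 0] r by (auto intro: DERIV_imp_deriv)
  ultimately show ?thesis
    by (simp add: r_def)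
qed

text \<open>Cauchy estimates bound the derivative uniformly on the convex set
  \<open>polydisc R\<close>, and the mean value inequality does the rest. The bound degenerates as
  \<open>R\<close> tends to 1, which is why trajectories are later confined to a smaller
  polydisc.\<close>

lemma holomorphic_scalar_lipschitz:
  fixes f :: "complex ^ 'n \<Rightarrow> complex"
  assumes f: "holomorphic_scalar f unit_polydisc" and R: "0 < R" "R < 1"
  obtains L where "0 \<le> L"
    "\<And>x y. x \<in> polydisc R \<Longrightarrow> y \<in> polydisc R \<Longrightarrow> cmod (f x - f y) \<le> L * norm (x - y)"
proof -
  \<comment> \<open>Half the distance to the boundary leaves room for circles of radius
    \<open>\<rho>\<close> inside a compact polydisc on which \<open>f\<close> is bounded.\<close>
  define \<rho> where "\<rho> = (1 - R) / 2"
  have \<rho>: "0 < \<rho>" "R + \<rho> < 1"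
    using R by (auto simp: \<rho>_def field_simps)
  have sub: "closed_polydisc (R + \<rho>) \<subseteq> (unit_polydisc :: (complex ^ 'n) set)"
    by (rule closed_polydisc_subset_polydisc) (rule \<rho>)
  have "compact (f ` closed_polydisc (R + \<rho>))"
    using continuous_on_subset[OF holomorphic_scalar_imp_continuous_on[OF f] sub]
      compact_closed_polydisc by (rule compact_continuous_image)
  then obtain M where M: "\<And>z. z \<in> closed_polydisc (R + \<rho>) \<Longrightarrow> cmod (f z) \<le> M"
    by (meson bounded_iff compact_imp_bounded imageI)
  have "0 \<in> (closed_polydisc (R + \<rho>) :: (complex ^ 'n) set)"
    using R \<rho> by (simp add: closed_polydisc_def)
  then have M0: "0 \<le> M / \<rho>"
    using M \<rho> by (metis divide_nonneg_pos norm_ge_zero order_trans)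
  have "cmod (f x - f y) \<le> M / \<rho> * norm (x - y)" if xy: "x \<in> polydisc R" "y \<in> polydisc R" for x y
  proof (rule differentiable_bound[OF convex_polydisc _ _ xy])
    fix z :: "complex ^ 'n" assume z: "z \<in> polydisc R"
    then have "z \<in> unit_polydisc"
      using polydisc_mono[of R 1] R by auto
    then show "(f has_derivative frechet_derivative f (at z)) (at z within polydisc R)"
      using holomorphic_scalar_frechet(1)[OF f] has_derivative_at_withinI by blast
    show "onorm (frechet_derivative f (at z)) \<le> M / \<rho>"
      using z polydisc_subset_closed_polydisc
      by (intro onorm_bound M0 frechet_Cauchy_estimate[OF f _ \<rho> M]) auto
  qed
  then show ?thesis
    using that M0 by blast
qed

lemma frechet_derivative_continuous_at_0:
  fixes f :: "complex ^ 'n \<Rightarrow> complex"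
  assumes f: "holomorphic_scalar f unit_polydisc" and e: "e > 0"
  obtains d where "0 < d" "d < 1"
    "\<And>z v. norm z < d \<Longrightarrow> cmod (frechet_derivative f (at z) v - frechet_derivative f (at 0) v) \<le> e * norm v"
proof -
  \<comment> \<open>The radii fit as 1/4 + 1/2 = 3/4 < 1: base points within 1/4, a margin of 1/2
    for Cauchy's inequality. Dividing by that margin turns the bound \<open>e / 2\<close> from
    uniform continuity into \<open>e\<close>.\<close>
  have sub: "closed_polydisc (3/4) \<subseteq> (unit_polydisc :: (complex ^ 'n) set)"
    by (rule closed_polydisc_subset_polydisc) simp
  have "uniformly_continuous_on (closed_polydisc (3/4)) f"
    using continuous_on_subset[OF holomorphic_scalar_imp_continuous_on[OF f] sub]
      compact_closed_polydisc by (intro compact_uniformly_continuous)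
  then obtain d where d: "d > 0" "\<And>x y. x \<in> closed_polydisc (3/4) \<Longrightarrow> y \<in> closed_polydisc (3/4) \<Longrightarrow>
      dist x y < d \<Longrightarrow> dist (f x) (f y) < e / 2"
    using e unfolding uniformly_continuous_on_def by (metis half_gt_zero)
  have "cmod (frechet_derivative f (at z) v - frechet_derivative f (at 0) v) \<le> e * norm v"
    if z: "norm z < min d (1/4)" for z v
  proof -
    have "cmod (frechet_derivative f (at z) v - frechet_derivative f (at 0) v) \<le> (e / 2) / (1/2) * norm v"
    proof (rule frechet_diff_Cauchy_estimate[OF f, where R = "1/4"])
      show "z \<in> closed_polydisc (1/4)"
        using z norm_nth_le_vec[of z] by (auto simp: closed_polydisc_def) (smt (verit))
      show "cmod (f (z + u) - f (0 + u)) \<le> e / 2"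
        if "z + u \<in> closed_polydisc (1/4 + 1/2)" "0 + u \<in> closed_polydisc (1/4 + 1/2)" for u
        using d(2)[of "z + u" u] that z by (simp add: dist_norm)
    qed (auto simp: closed_polydisc_def)
    then show ?thesis
      by simp
  qed
  then show ?thesis
    using d(1) by (intro that[of "min d (1/4)"]) auto
qed

text \<open>The mean value inequality is applied to \<open>f\<close> minus its differential at 0,
  whose derivative is small near 0. Plain differentiability at 0 would give an error small relative
  to the norms of \<open>x\<close> and \<open>y\<close>, whereas an error small relative to their
  distance is wanted.\<close>

lemma holomorphic_scalar_strictly_differentiable:
  fixes f :: "complex ^ 'n \<Rightarrow> complex"
  assumes f: "holomorphic_scalar f unit_polydisc" and e: "e > 0"
  obtains d where "0 < d"
    "\<And>x y. norm x < d \<Longrightarrow> norm y < d \<Longrightarrow>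
      cmod (f x - f y - frechet_derivative f (at 0) (x - y)) \<le> e * norm (x - y)"
proof -
  let ?D = "frechet_derivative f (at 0)"
  obtain d where d: "0 < d" "d < 1"
    "\<And>z v. norm z < d \<Longrightarrow> cmod (frechet_derivative f (at z) v - ?D v) \<le> e * norm v"
    using frechet_derivative_continuous_at_0[OF f e] by metis
  have D0: "(f has_derivative ?D) (at 0)"
    using holomorphic_scalar_frechet(1)[OF f, of 0] by simp
  have "cmod (f x - f y - ?D (x - y)) \<le> e * norm (x - y)" if xy: "norm x < d" "norm y < d" for x y
  proof -
    have "norm ((f x - ?D x) - (f y - ?D y)) \<le> e * norm (x - y)"
    proof (rule differentiable_bound[OF convex_ball[of 0 d]])
      fix z :: "complex ^ 'n" assume z: "z \<in> ball 0 d"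
      then have "z \<in> unit_polydisc"
        using ball_subset_polydisc[of 1] d(2) by (force simp: subset_iff)
      then show "((\<lambda>z. f z - ?D z) has_derivative (\<lambda>v. frechet_derivative f (at z) v - ?D v))
          (at z within ball 0 d)"
        by (intro has_derivative_diff bounded_linear_imp_has_derivative
            has_derivative_bounded_linear[OF D0]
            has_derivative_at_withinI[OF holomorphic_scalar_frechet(1)[OF f]])
      show "onorm (\<lambda>v. frechet_derivative f (at z) v - ?D v) \<le> e"
        using z e d(3) by (intro onorm_bound) auto
    qed (use xy in auto)
    moreover have "?D (x - y) = ?D x - ?D y"
      using linear_diff[OF has_derivative_linear[OF D0]] .
    moreover have "f x - f y - (?D x - ?D y) = (f x - ?D x) - (f y - ?D y)"
      by simp
    ultimately show ?thesis
      by (simp only:)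
  qed
  then show ?thesis
    using that d(1) by blast
qed

subsection \<open>First order Taylor coefficients\<close>

text \<open>On the \<open>k\<close>-th axis only multi-indices supported at \<open>k\<close>
  survive, and what remains is a one-variable power series whose derivative at 0 is its coefficient
  of index 1.\<close>

lemma taylor_coeff_single:
  fixes f :: "complex ^ 'n \<Rightarrow> complex"
  assumes f: "holomorphic_scalar f unit_polydisc"
  shows "taylor_coeff f (\<lambda>i. if i = k then 1 else 0) = partial_deriv k f 0"
proof -
  define e where "e m = (\<lambda>i. if i = k then m else 0)" for m :: nat
  define c where "c m = taylor_coeff f (e m)" for m
  have line: "s *s axis k 1 \<in> (unit_polydisc :: (complex ^ 'n) set)" if "cmod s < 1" for s
    using that by (auto simp: polydisc_def axis_def)
  have mon: "monomial (e m) (s *s axis k 1 :: complex ^ 'n) = s ^ m" for s m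
  proof -
    have "monomial (e m) (s *s axis k 1 :: complex ^ 'n) = (\<Prod>i\<in>UNIV. if i = k then s ^ m else 1)"
      by (intro prod.cong) (auto simp: e_def axis_def)
    then show ?thesis
      by simp
  qed
  have sums: "(\<lambda>m. c m * s ^ m) sums f (s *s axis k 1)" if "cmod s < 1" for s
  proof -
    have inj: "inj e"
      by (auto simp: inj_def e_def fun_eq_iff)
    have zero: "monomial \<alpha> (s *s axis k 1 :: complex ^ 'n) = 0" if "\<alpha> \<notin> range e" for \<alpha>
    proof -
      have "\<exists>i. i \<noteq> k \<and> \<alpha> i \<noteq> 0"
      proof (rule ccontr)
        assume "\<not> ?thesis"
        then have "\<alpha> = e (\<alpha> k)"
          by (auto simp: e_def fun_eq_iff)
        then show False
          using that by blast
      qed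
      then show ?thesis
        by (auto simp: axis_def intro!: prod_zero)
    qed
    have "((\<lambda>\<alpha>. taylor_coeff f \<alpha> * monomial \<alpha> (s *s axis k 1)) has_sum f (s *s axis k 1)) (range e)"
      using has_sum_taylor_coeff[OF f line[OF that]]
    proof (rule has_sum_cong_neutral[THEN iffD1, rotated -1])
      show "taylor_coeff f \<alpha> * monomial \<alpha> (s *s axis k 1) = 0" if "\<alpha> \<in> UNIV - range e" for \<alpha>
      proof -
        have "\<alpha> \<notin> range e"
          using that by blast
        from zero[OF this] show ?thesis
          by (simp only: mult_zero_right)
      qed
    qed auto
    then have "((\<lambda>m. c m * s ^ m) has_sum f (s *s axis k 1)) UNIV"
      by (subst (asm) has_sum_reindex[OF inj]) (simp only: o_def mon c_def)
    then show ?thesis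
      by (rule has_sum_imp_sums)
  qed
  \<comment> \<open>Convergence at some nonzero point suffices for termwise differentiation at
    0.\<close>
  have "summable (\<lambda>m. c m * (1/2) ^ m)"
    using sums[of "1/2"] by (auto simp: summable_def)
  from termdiffs_strong[OF this, of 0]
  have "((\<lambda>s. \<Sum>m. c m * s ^ m) has_field_derivative c 1) (at 0)"
    by (simp add: powser_zero diffs_def)
  then have "((\<lambda>s. f (s *s axis k 1)) has_field_derivative c 1) (at 0)"
    by (rule has_field_derivative_transform_within_open[of _ _ _ "ball 0 1"])
      (auto simp: sums_unique[OF sums])
  then show ?thesis
    unfolding partial_deriv_def c_def e_def by (simp only: add_0_left DERIV_imp_deriv)
qed

subsection \<open>Elements of the Hardy space\<close>

lemma closed_torus: "closed (torus :: (complex ^ 'n) set)"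
proof -
  have "torus = (\<Inter>k. {z :: complex ^ 'n. cmod (z $ k) = 1})"
    by (auto simp: torus_def)
  moreover have "closed {z :: complex ^ 'n. cmod (z $ k) = 1}" for k
    by (intro closed_Collect_eq continuous_intros)
  ultimately show ?thesis
    by (metis (no_types, lifting) closed_INT)
qed

lemma compact_torus: "compact (torus :: (complex ^ 'n) set)"
proof -
  have "torus = torus \<inter> (closed_polydisc 1 :: (complex ^ 'n) set)"
    by (auto simp: torus_def closed_polydisc_def)
  then show ?thesis
    using closed_Int_compact[OF closed_torus compact_closed_polydisc] by metis
qed

lemma
  shows sets_torus_measure: "sets (torus_measure :: (complex ^ 'n) measure) = sets borel"
    and finite_measure_torus_measure: "finite_measure (torus_measure :: (complex ^ 'n) measure)"
    and AE_torus_measure: "AE w in (torus_measure :: (complex ^ 'n) measure). w \<in> torus"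
proof -
  let ?B = "cbox 0 (\<chi> i. 2 * pi) :: (real ^ 'n) set"
  let ?g = "\<lambda>\<theta> :: real ^ 'n. (\<chi> i. cis (\<theta> $ i)) :: complex ^ 'n"
  have "(\<lambda>\<theta> :: real ^ 'n. cis (\<theta> $ i)) \<in> borel_measurable borel" for i
    by (intro borel_measurable_continuous_onI continuous_on_cis continuous_intros)
  then have "?g \<in> borel_measurable borel"
    by (rule borel_measurable_vec_lambda)
  then have g: "?g \<in> borel_measurable (uniform_measure lborel ?B)"
    by simp
  show "sets (torus_measure :: (complex ^ 'n) measure) = sets borel"
    by (simp add: torus_measure_def)
  \<comment> \<open>An interior point shows that the box has positive volume, so the uniform measure
    on it has total mass 1.\<close>
  have "(\<chi> i. pi) \<in> box 0 (\<chi> i. 2 * pi :: real ^ 'n)"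
    unfolding mem_box_cart by simp
  then have "measure lborel ?B \<noteq> 0"
    unfolding content_eq_0_interior interior_cbox by blast
  then have pos: "emeasure lborel ?B \<noteq> 0"
    unfolding measure_def by fastforce
  have fin: "emeasure lborel ?B \<noteq> \<infinity>"
    using emeasure_lborel_cbox_finite[of "0 :: real ^ 'n" "\<chi> i. 2 * pi"] by simp
  have "emeasure (uniform_measure lborel ?B) UNIV = emeasure lborel (?B \<inter> UNIV) / emeasure lborel ?B"
    by (rule emeasure_uniform_measure) simp_all
  also have "\<dots> = 1"
    using pos fin by (simp only: Int_UNIV_right) (simp add: ennreal_divide_self less_top)
  finally have "emeasure (uniform_measure lborel ?B) (space (uniform_measure lborel ?B)) \<noteq> \<infinity>"
    by simp
  then have "finite_measure (uniform_measure lborel ?B)"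
    by standard
  from finite_measure.finite_measure_distr[OF this g]
  show "finite_measure (torus_measure :: (complex ^ 'n) measure)"
    by (simp add: torus_measure_def)
  show "AE w in (torus_measure :: (complex ^ 'n) measure). w \<in> torus"
    unfolding torus_measure_def
    by (subst AE_distr_iff[OF g]) (auto simp: torus_def closed_torus[unfolded torus_def])
qed

text \<open>A continuous extension to the torus gives the limit of the integral means by dominated
  convergence. All members of the Hardy space constructed below come from this criterion.\<close>

lemma hardy_memI:
  fixes f G :: "complex ^ 'n \<Rightarrow> complex"
  assumes f: "holomorphic_scalar f unit_polydisc" and outside: "\<And>z. z \<notin> unit_polydisc \<Longrightarrow> f z = 0"
    and G: "continuous_on (unit_polydisc \<union> torus) G" and fG: "\<And>z. z \<in> unit_polydisc \<Longrightarrow> f z = G z"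
  shows "f \<in> hardy"
proof -
  interpret finite_measure "torus_measure :: (complex ^ 'n) measure"
    by (rule finite_measure_torus_measure)
  note [measurable_cong] = sets_torus_measure
  \<comment> \<open>\<open>G\<close> is continuous on the open polydisc and the torus only, not on
    the rest of the topological boundary. The radial segments ending on the torus form a compact set
    that avoids this rest, so \<open>G\<close> is bounded there.\<close>
  define K where "K = (\<lambda>(r, w). r *\<^sub>R w) ` ({0..1 :: real} \<times> (torus :: (complex ^ 'n) set))"
  have K: "K \<subseteq> unit_polydisc \<union> torus"
  proof
    fix z assume "z \<in> K"
    then obtain r and w :: "complex ^ 'n" where rw: "z = r *\<^sub>R w" "0 \<le> r" "r \<le> 1" "w \<in> torus"
      by (auto simp: K_def)
    show "z \<in> unit_polydisc \<union> torus"
      using rw by (cases "r = 1") (auto simp: polydisc_def torus_def)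
  qed
  have "compact K"
    unfolding K_def split_def
    by (intro compact_continuous_image compact_Times compact_torus compact_Icc continuous_intros)
  then have "compact (G ` K)"
    using continuous_on_subset[OF G K] by (intro compact_continuous_image)
  then obtain M where M: "\<And>z. z \<in> K \<Longrightarrow> cmod (G z) \<le> M"
    by (meson bounded_iff compact_imp_bounded imageI)
  have "(\<lambda>z. if z \<in> unit_polydisc then f z else 0) \<in> borel_measurable borel"
    using holomorphic_scalar_imp_continuous_on[OF f]
    by (intro borel_measurable_continuous_on_if borel_open[OF open_polydisc]) auto
  then have [measurable]: "f \<in> borel_measurable borel"
    by (rule measurable_cong[THEN iffD1, rotated]) (simp add: outside)
  \<comment> \<open>Cutting \<open>G\<close> off outside the torus makes it Borel on the whole
    space; almost every \<open>w\<close> lies on the torus, where the values are unchanged.\<close>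
  define H where "H = (\<lambda>w. if w \<in> torus then G w else 0)"
  have [measurable]: "H \<in> borel_measurable borel"
    unfolding H_def using continuous_on_subset[OF G]
    by (intro borel_measurable_continuous_on_if borel_closed[OF closed_torus]) auto
  have "((\<lambda>r. \<integral>w. (cmod (f (r *\<^sub>R w)))\<^sup>2 \<partial>torus_measure) \<longlongrightarrow> (\<integral>w. (cmod (H w))\<^sup>2 \<partial>torus_measure)) (at_left 1)"
  proof (rule tendsto_at_left_sequentially[of 0])
    fix S :: "nat \<Rightarrow> real"
    assume S: "\<And>n. S n < 1" "\<And>n. 0 < S n" "S \<longlonglongrightarrow> 1"
    have inD: "S n *\<^sub>R w \<in> unit_polydisc" "S n *\<^sub>R w \<in> K" if "w \<in> torus" for n and w :: "complex ^ 'n"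
    proof -
      show "S n *\<^sub>R w \<in> unit_polydisc"
        using that S(1,2)[of n] by (auto simp: polydisc_def torus_def)
      have "(S n, w) \<in> {0..1} \<times> torus"
        using that S(1,2)[of n] by simp
      then show "S n *\<^sub>R w \<in> K"
        unfolding K_def by force
    qed
    show "(\<lambda>n. \<integral>w. (cmod (f (S n *\<^sub>R w)))\<^sup>2 \<partial>torus_measure) \<longlonglongrightarrow> (\<integral>w. (cmod (H w))\<^sup>2 \<partial>torus_measure)"
    proof (rule integral_dominated_convergence[where w = "\<lambda>_. M\<^sup>2"])
      show "AE w in torus_measure. (\<lambda>n. (cmod (f (S n *\<^sub>R w)))\<^sup>2) \<longlonglongrightarrow> (cmod (H w))\<^sup>2"
        using AE_torus_measure
      proof eventually_elim
        case (elim w)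
        have "(\<lambda>n. G (S n *\<^sub>R w)) \<longlonglongrightarrow> G w"
        proof (rule continuous_on_tendsto_compose[OF G])
          show "(\<lambda>n. S n *\<^sub>R w) \<longlonglongrightarrow> w"
            using tendsto_scaleR[OF S(3) tendsto_const[of w]] by simp
        qed (use elim inD in auto)
        then have "(\<lambda>n. f (S n *\<^sub>R w)) \<longlonglongrightarrow> H w"
          using elim inD by (simp add: H_def fG)
        then show ?case
          by (intro tendsto_intros)
      qed
      show "AE w in torus_measure. norm ((cmod (f (S n *\<^sub>R w)))\<^sup>2) \<le> M\<^sup>2" for n
        using AE_torus_measure by eventually_elim (auto simp: fG inD intro!: power_mono M)
    qed auto
  qed simp
  then show ?thesis
    using f outside unfolding hardy_def by blast
qed

lemma hardy_restrict_memI: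
  assumes "holomorphic_scalar G unit_polydisc" "continuous_on (unit_polydisc \<union> torus) G"
  shows "(\<lambda>z. if z \<in> unit_polydisc then G z else 0) \<in> hardy"
proof (rule hardy_memI[OF _ _ assms(2)])
  show "holomorphic_scalar (\<lambda>z. if z \<in> unit_polydisc then G z else 0) unit_polydisc"
    using holomorphic_scalar_cong[OF open_polydisc, of 1 "\<lambda>z. if z \<in> unit_polydisc then G z else 0" G]
      assms(1) by simp
qed auto

lemma hardy_holomorphic: "f \<in> hardy \<Longrightarrow> holomorphic_scalar f unit_polydisc"
  and hardy_outside: "f \<in> hardy \<Longrightarrow> z \<notin> unit_polydisc \<Longrightarrow> f z = 0"
  by (auto simp: hardy_def)

section \<open>Monomials as test functions\<close>

lemma hardy_ext:
  assumes "f \<in> hardy" "g \<in> hardy" "taylor_coeff f = taylor_coeff g"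
  shows "f = g"
proof
  fix z
  show "f z = g z"
  proof (cases "z \<in> unit_polydisc")
    case True
    then show ?thesis
      using has_sum_taylor_coeff[OF hardy_holomorphic[OF assms(1)] True]
        has_sum_taylor_coeff[OF hardy_holomorphic[OF assms(2)] True] assms(3) has_sum_unique
      by metis
  qed (simp add: hardy_outside[OF assms(1)] hardy_outside[OF assms(2)])
qed

lemma cnj_hardy_inner: "cnj (hardy_inner f g) = hardy_inner g f"
  unfolding hardy_inner_def by (simp flip: infsum_cnj add: mult.commute)

definition hardy_monomial :: "('n \<Rightarrow> nat) \<Rightarrow> complex ^ 'n \<Rightarrow> complex" where
  "hardy_monomial \<beta> z = (if z \<in> unit_polydisc then monomial \<beta> z else 0)"

lemma holomorphic_monomial: "holomorphic_scalar (monomial \<beta>) S"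
  by (intro holomorphic_scalar_prod holomorphic_scalar_power holomorphic_scalar_nth)

lemma hardy_monomial_mem: "hardy_monomial \<beta> \<in> hardy"
  unfolding hardy_monomial_def
  by (intro hardy_restrict_memI holomorphic_monomial continuous_intros)

lemma taylor_coeff_hardy_monomial:
  fixes \<beta> :: "'n :: finite \<Rightarrow> nat"
  shows "taylor_coeff (hardy_monomial \<beta>) = (\<lambda>\<alpha>. if \<alpha> = \<beta> then 1 else 0)"
proof (rule taylor_coeff_unique)
  fix z :: "complex ^ 'n" assume "z \<in> unit_polydisc"
  then show "((\<lambda>\<alpha>. (if \<alpha> = \<beta> then 1 else 0) * monomial \<alpha> z) has_sum hardy_monomial \<beta> z) UNIV"
    by (intro has_sum_finite_neutralI[where B = "{\<beta>}"]) (auto simp: hardy_monomial_def)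
qed

lemma hardy_inner_monomial: "hardy_inner (hardy_monomial \<beta>) g = cnj (taylor_coeff g \<beta>)"
  unfolding hardy_inner_def
  by (rule infsumI, rule has_sum_finite_neutralI[where B = "{\<beta>}"])
    (auto simp: taylor_coeff_hardy_monomial)

text \<open>Evaluates the definite description of the adjoint. Monomials in the domain play the role
  of density: pairing with them reads off all Taylor coefficients, which determine an element of the
  Hardy space.\<close>

lemma adjoint_op_eqI:
  assumes D: "range hardy_monomial \<subseteq> D" and g': "g' \<in> hardy"
    and adj: "\<And>u. u \<in> D \<Longrightarrow> hardy_inner (T u) g = hardy_inner u g'"
  shows "adjoint_op D T g = g'"
  unfolding adjoint_op_def
proof (rule the_equality)
  fix g'' assume g'': "g'' \<in> hardy \<and> (\<forall>u\<in>D. hardy_inner (T u) g = hardy_inner u g'')"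
  have "taylor_coeff g'' \<beta> = taylor_coeff g' \<beta>" for \<beta>
  proof -
    have "hardy_monomial \<beta> \<in> D"
      using D by blast
    then have "hardy_inner (hardy_monomial \<beta>) g'' = hardy_inner (hardy_monomial \<beta>) g'"
      using g'' adj by metis
    then show ?thesis
      by (simp add: hardy_inner_monomial)
  qed
  then show "g'' = g'"
    using g'' g' by (intro hardy_ext) auto
qed (use g' adj in auto)

subsection \<open>Reproducing kernels and the adjoint of the Koopman operator\<close>

definition kernel_diff :: "complex ^ 'n \<Rightarrow> complex ^ 'n \<Rightarrow> complex ^ 'n \<Rightarrow> complex" where
  "kernel_diff z z' w = hardy_kernel z w - hardy_kernel z' w"

text \<open>The coordinates of \<open>z\<close> lie strictly inside the disc, so \<open>w\<close>
  may go up to the torus; the kernels therefore extend continuously to it, as the membership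
  criterion requires.\<close>

lemma kernel_factor_nonzero:
  fixes z w :: "complex ^ 'n"
  assumes "z \<in> unit_polydisc" "w \<in> unit_polydisc \<union> torus"
  shows "1 - cnj (z $ i) * w $ i \<noteq> 0"
proof
  assume "1 - cnj (z $ i) * w $ i = 0"
  then have "cmod (cnj (z $ i) * w $ i) = 1"
    by simp
  moreover have "cmod (w $ i) \<le> 1" "cmod (z $ i) < 1"
    using assms by (auto simp: polydisc_def torus_def less_imp_le)
  ultimately show False
    using mult_left_le[of "cmod (w $ i)" "cmod (z $ i)"] by (simp add: norm_mult)
qed

lemma kernel_diff_mem:
  fixes z z' :: "complex ^ 'n"
  assumes z: "z \<in> unit_polydisc" "z' \<in> unit_polydisc"
  shows "kernel_diff z z' \<in> hardy"
proof -
  define G where "G z w = (\<Prod>i\<in>UNIV. inverse (1 - cnj (z $ i) * w $ i))" for z w :: "complex ^ 'n"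
  have hol: "holomorphic_scalar (G z) unit_polydisc" if "z \<in> unit_polydisc" for z
    unfolding G_def
  proof (intro holomorphic_scalar_prod)
    fix i
    have "holomorphic_scalar (\<lambda>w. 1 - cnj (z $ i) * w $ i) unit_polydisc"
      by (intro holomorphic_scalar_diff holomorphic_scalar_const holomorphic_scalar_cmult
          holomorphic_scalar_nth)
    then show "holomorphic_scalar (\<lambda>w. inverse (1 - cnj (z $ i) * w $ i)) unit_polydisc"
      by (rule holomorphic_scalar_compose_field[OF _ DERIV_inverse])
        (use kernel_factor_nonzero[OF that] in auto)
  qed
  have cont: "continuous_on (unit_polydisc \<union> torus) (G z)" if "z \<in> unit_polydisc" for z
    unfolding G_def using kernel_factor_nonzero[OF that] by (intro continuous_intros) auto
  have "(\<lambda>w. if w \<in> unit_polydisc then G z w - G z' w else 0) \<in> hardy"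
    by (intro hardy_restrict_memI holomorphic_scalar_diff hol cont z continuous_on_diff)
  also have "(\<lambda>w. if w \<in> unit_polydisc then G z w - G z' w else 0) = kernel_diff z z'"
    by (auto simp: kernel_diff_def hardy_kernel_def G_def)
  finally show ?thesis .
qed

text \<open>The multi-index geometric series in the products of \<open>cnj (z $ i)\<close> and
  \<open>w $ i\<close>; the conjugation reflects that kernels depend antiholomorphically on their
  base point.\<close>

lemma taylor_coeff_kernel_diff:
  fixes z z' :: "complex ^ 'n"
  assumes z: "z \<in> unit_polydisc" "z' \<in> unit_polydisc"
  shows "taylor_coeff (kernel_diff z z') = (\<lambda>\<alpha>. cnj (monomial \<alpha> z - monomial \<alpha> z'))"
proof (rule taylor_coeff_unique)
  fix w :: "complex ^ 'n" assume w: "w \<in> unit_polydisc"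
  have "((\<lambda>\<alpha>. cnj (monomial \<alpha> z) * monomial \<alpha> w) has_sum hardy_kernel z w) UNIV"
    if "z \<in> unit_polydisc" for z :: "complex ^ 'n"
  proof -
    have "cmod (cnj (z $ i) * w $ i) < 1" for i
      using that w mult_strict_mono'[of "cmod (z $ i)" 1 "cmod (w $ i)" 1]
      by (simp add: polydisc_def norm_mult)
    from summable_on_prod_geometric(2)[OF this] show ?thesis
      using w by (simp add: hardy_kernel_def power_mult_distrib prod.distrib)
  qed
  from has_sum_add[OF this[OF z(1)] has_sum_uminusI[OF this[OF z(2)]]]
  show "((\<lambda>\<alpha>. cnj (monomial \<alpha> z - monomial \<alpha> z') * monomial \<alpha> w) has_sum kernel_diff z z' w) UNIV"
    by (simp add: kernel_diff_def algebra_simps)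
qed

text \<open>The reproducing property: pairing with the coefficients of the kernels reassembles the
  Taylor series of \<open>f\<close> at the two base points.\<close>

lemma hardy_inner_kernel_diff:
  fixes f :: "complex ^ 'n \<Rightarrow> complex"
  assumes f: "holomorphic_scalar f unit_polydisc" and z: "z \<in> unit_polydisc" "z' \<in> unit_polydisc"
  shows "hardy_inner f (kernel_diff z z') = f z - f z'"
proof -
  have "((\<lambda>\<alpha>. taylor_coeff f \<alpha> * monomial \<alpha> z - taylor_coeff f \<alpha> * monomial \<alpha> z') has_sum f z - f z') UNIV"
    using has_sum_add[OF has_sum_taylor_coeff[OF f z(1)] has_sum_uminusI[OF has_sum_taylor_coeff[OF f z(2)]]]
    by simp
  then show ?thesis
    unfolding hardy_inner_def taylor_coeff_kernel_diff[OF z]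
    by (intro infsumI) (simp add: algebra_simps)
qed

text \<open>By the reproducing property, both sides of the adjoint relation equal
  \<open>u (\<phi> t z) - u (\<phi> t z')\<close>.\<close>

lemma koopman_adjoint_kernel_diff:
  fixes F :: "complex ^ 'n \<Rightarrow> complex ^ 'n"
  assumes flow: "holomorphic_flow F \<phi>" and t: "t \<ge> 0"
    and z: "z \<in> unit_polydisc" "z' \<in> unit_polydisc"
  shows "koopman_adjoint \<phi> t (kernel_diff z z') = kernel_diff (\<phi> t z) (\<phi> t z')"
  unfolding koopman_adjoint_def
proof (rule adjoint_op_eqI)
  have \<phi>: "\<phi> t z \<in> unit_polydisc" if "z \<in> unit_polydisc" for z
    using flow t that by (auto simp: holomorphic_flow_def)
  have hol: "holomorphic_vector (\<phi> t) unit_polydisc"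
    using flow t by (auto simp: holomorphic_flow_def)
  show "range hardy_monomial \<subseteq> hardy"
    using hardy_monomial_mem by auto
  show "kernel_diff (\<phi> t z) (\<phi> t z') \<in> hardy"
    by (intro kernel_diff_mem \<phi> z)
  fix u :: "complex ^ 'n \<Rightarrow> complex"
  assume u: "u \<in> hardy"
  have "holomorphic_scalar (koopman \<phi> t u) unit_polydisc"
    using holomorphic_scalar_compose[OF hardy_holomorphic[OF u] hol \<phi>]
      holomorphic_scalar_cong[OF open_polydisc, of 1 "koopman \<phi> t u" "\<lambda>z. u (\<phi> t z)"]
    by (simp add: koopman_def)
  then show "hardy_inner (koopman \<phi> t u) (kernel_diff z z') = hardy_inner u (kernel_diff (\<phi> t z) (\<phi> t z'))"
    using z u by (simp add: hardy_inner_kernel_diff hardy_holomorphic \<phi> koopman_def)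
qed

subsection \<open>Principal eigenfunctions of the adjoint generator\<close>

text \<open>For \<open>\<beta> i = 0\<close> the truncated exponent \<open>\<beta> i - 1\<close> is
  harmless, since the factor \<open>of_nat (\<beta> i)\<close> vanishes.\<close>

lemma partial_deriv_hardy_monomial:
  fixes z :: "complex ^ 'n"
  assumes z: "z \<in> unit_polydisc"
  shows "partial_deriv i (hardy_monomial \<beta>) z
    = of_nat (\<beta> i) * z $ i ^ (\<beta> i - 1) * (\<Prod>j\<in>UNIV - {i}. z $ j ^ \<beta> j)"
proof -
  define S where "S = (\<lambda>s. z + s *s axis i 1) -` unit_polydisc"
  have "open S"
    unfolding S_def by (intro open_vimage open_polydisc continuous_intros)
  moreover have "0 \<in> S"
    using z by (simp add: S_def)
  moreover have "hardy_monomial \<beta> (z + s *s axis i 1) = (z $ i + s) ^ \<beta> i * (\<Prod>j\<in>UNIV - {i}. z $ j ^ \<beta> j)"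
    if "s \<in> S" for s
  proof -
    have "hardy_monomial \<beta> (z + s *s axis i 1)
        = (z + s *s axis i 1) $ i ^ \<beta> i * (\<Prod>j\<in>UNIV - {i}. (z + s *s axis i 1) $ j ^ \<beta> j)"
      using that unfolding hardy_monomial_def S_def by (subst prod.remove[of _ i]) auto
    also have "(\<Prod>j\<in>UNIV - {i}. (z + s *s axis i 1) $ j ^ \<beta> j) = (\<Prod>j\<in>UNIV - {i}. z $ j ^ \<beta> j)"
      by (intro prod.cong) (auto simp: axis_def)
    finally show ?thesis
      by (simp add: axis_def)
  qed
  moreover have "((\<lambda>s. (z $ i + s) ^ \<beta> i * (\<Prod>j\<in>UNIV - {i}. z $ j ^ \<beta> j)) has_field_derivative
      of_nat (\<beta> i) * z $ i ^ (\<beta> i - 1) * (\<Prod>j\<in>UNIV - {i}. z $ j ^ \<beta> j)) (at 0)"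
    by (auto intro!: derivative_eq_intros)
  ultimately have "((\<lambda>s. hardy_monomial \<beta> (z + s *s axis i 1)) has_field_derivative
      of_nat (\<beta> i) * z $ i ^ (\<beta> i - 1) * (\<Prod>j\<in>UNIV - {i}. z $ j ^ \<beta> j)) (at 0)"
    by (elim has_field_derivative_transform_within_open) auto
  then show ?thesis
    unfolding partial_deriv_def by (rule DERIV_imp_deriv)
qed

text \<open>The generator sends a monomial to a combination of the components of \<open>F\<close>
  with polynomial coefficients, and this is continuous up to the torus because \<open>F\<close> is.
  Adjoints of the generator can thus be identified by testing on monomials.\<close>

lemma hardy_monomial_generator_domain:
  fixes F :: "complex ^ 'n \<Rightarrow> complex ^ 'n"
  assumes F: "holomorphic_vector F unit_polydisc" "continuous_on (unit_polydisc \<union> torus) F"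
  shows "range hardy_monomial \<subseteq> generator_domain F"
proof
  fix u :: "complex ^ 'n \<Rightarrow> complex"
  assume "u \<in> range hardy_monomial"
  then obtain \<beta> where u: "u = hardy_monomial \<beta>"
    by auto
  define G where "G z = (\<Sum>i\<in>UNIV. F z $ i *
      (of_nat (\<beta> i) * z $ i ^ (\<beta> i - 1) * (\<Prod>j\<in>UNIV - {i}. z $ j ^ \<beta> j)))" for z
  have "generator F u = (\<lambda>z. if z \<in> unit_polydisc then G z else 0)"
    by (auto simp: generator_def u partial_deriv_hardy_monomial G_def)
  also have "\<dots> \<in> hardy"
  proof (rule hardy_restrict_memI)
    show "holomorphic_scalar G unit_polydisc"
      unfolding G_def using F(1)[unfolded holomorphic_vector_def]
      by (intro holomorphic_scalar_sum holomorphic_scalar_mult holomorphic_scalar_const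
          holomorphic_scalar_power holomorphic_scalar_prod holomorphic_scalar_nth) auto
    show "continuous_on (unit_polydisc \<union> torus) G"
      unfolding G_def by (intro continuous_intros F(2))
  qed
  finally show "u \<in> generator_domain F"
    by (simp add: generator_domain_def u hardy_monomial_mem)
qed

text \<open>The Riesz representative of the functional that takes the differential at 0 in direction
  \<open>v\<close>; the conjugates make the pairing linear in \<open>v\<close>.\<close>

definition hardy_linear :: "complex ^ 'n \<Rightarrow> complex ^ 'n \<Rightarrow> complex" where
  "hardy_linear v z = (if z \<in> unit_polydisc then \<Sum>k\<in>UNIV. cnj (v $ k) * z $ k else 0)"

lemma hardy_linear_mem: "hardy_linear v \<in> hardy"
  unfolding hardy_linear_def
  by (intro hardy_restrict_memI holomorphic_scalar_sum holomorphic_scalar_cmult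
      holomorphic_scalar_nth continuous_intros)

lemma hardy_linear_scale: "hardy_linear (c *s v) = (\<lambda>z. cnj c * hardy_linear v z)"
  by (auto simp: hardy_linear_def sum_distrib_left mult.assoc)

lemma hardy_linear_nonzero:
  assumes "v \<noteq> 0"
  shows "hardy_linear v \<noteq> (\<lambda>z. 0)"
proof -
  obtain k where k: "v $ k \<noteq> 0"
    using assms by (auto simp: vec_eq_iff)
  have "(1/2) *s axis k 1 \<in> (unit_polydisc :: (complex ^ 'a) set)"
    by (auto simp: polydisc_def axis_def)
  then have "hardy_linear v ((1/2) *s axis k 1) = (\<Sum>i\<in>UNIV. if i = k then cnj (v $ k) / 2 else 0)"
    unfolding hardy_linear_def by (simp only: if_True) (rule sum.cong, auto simp: axis_def)
  also have "\<dots> = cnj (v $ k) / 2"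
    by simp
  finally have "hardy_linear v ((1/2) *s axis k 1) = cnj (v $ k) / 2" .
  moreover have "cnj (v $ k) / 2 \<noteq> 0"
    using k by simp
  ultimately have "hardy_linear v ((1/2) *s axis k 1) \<noteq> 0"
    by metis
  then show ?thesis
    by metis
qed

lemma hardy_inner_linear:
  fixes f :: "complex ^ 'n \<Rightarrow> complex"
  assumes f: "holomorphic_scalar f unit_polydisc"
  shows "hardy_inner f (hardy_linear v) = frechet_derivative f (at 0) v"
proof -
  define e :: "'n \<Rightarrow> 'n \<Rightarrow> nat" where "e k = (\<lambda>i. if i = k then 1 else 0)" for k
  have inj: "e k = e l \<longleftrightarrow> k = l" for k l
    by (auto simp: e_def fun_eq_iff split: if_splits)
  have mon: "monomial (e k) z = z $ k" for k and z :: "complex ^ 'n"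
  proof -
    have "monomial (e k) z = (\<Prod>i\<in>UNIV. if i = k then z $ k else 1)"
      by (intro prod.cong) (auto simp: e_def)
    then show ?thesis
      by simp
  qed
  \<comment> \<open>The coefficients are supported on the unit multi-indices \<open>e k\<close>; at
    most one summand is nonzero for each \<open>\<alpha>\<close>.\<close>
  have coeff: "taylor_coeff (hardy_linear v) = (\<lambda>\<alpha>. \<Sum>k\<in>UNIV. if \<alpha> = e k then cnj (v $ k) else 0)"
  proof (rule taylor_coeff_unique)
    fix z :: "complex ^ 'n" assume z: "z \<in> unit_polydisc"
    show "((\<lambda>\<alpha>. (\<Sum>k\<in>UNIV. if \<alpha> = e k then cnj (v $ k) else 0) * monomial \<alpha> z) has_sum hardy_linear v z) UNIV"
    proof (rule has_sum_finite_neutralI[where B = "range e"])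
      have "hardy_linear v z = (\<Sum>l\<in>UNIV. cnj (v $ l) * monomial (e l) z)"
        using z by (simp only: mon hardy_linear_def if_True)
      also have "\<dots> = (\<Sum>l\<in>UNIV. (\<Sum>k\<in>UNIV. if e l = e k then cnj (v $ k) else 0) * monomial (e l) z)"
        by (simp add: inj)
      also have "\<dots> = (\<Sum>\<alpha>\<in>range e. (\<Sum>k\<in>UNIV. if \<alpha> = e k then cnj (v $ k) else 0) * monomial \<alpha> z)"
        by (subst sum.reindex) (auto simp: inj_def inj)
      finally show "hardy_linear v z = \<dots>" .
    qed (auto intro!: sum.neutral)
  qed
  have "hardy_inner f (hardy_linear v) = (\<Sum>l\<in>UNIV. v $ l * partial_deriv l f 0)"
    unfolding hardy_inner_def coeff
  proof (rule infsumI, rule has_sum_finite_neutralI[where B = "range e"])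
    have "(\<Sum>l\<in>UNIV. v $ l * partial_deriv l f 0) = (\<Sum>l\<in>UNIV. taylor_coeff f (e l) * v $ l)"
      unfolding e_def taylor_coeff_single[OF f] by (simp add: mult.commute)
    also have "\<dots> = (\<Sum>l\<in>UNIV. taylor_coeff f (e l) * cnj (\<Sum>k\<in>UNIV. if e l = e k then cnj (v $ k) else 0))"
    proof -
      have "(\<Sum>k\<in>UNIV. if e l = e k then cnj (v $ k) else 0) = cnj (v $ l)" for l
        by (simp add: inj)
      then show ?thesis
        by (simp only: complex_cnj_cnj)
    qed
    also have "\<dots> = (\<Sum>\<alpha>\<in>range e. taylor_coeff f \<alpha> * cnj (\<Sum>k\<in>UNIV. if \<alpha> = e k then cnj (v $ k) else 0))"
      by (subst sum.reindex) (simp_all only: inj_def inj o_def, simp)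
    finally show "(\<Sum>l\<in>UNIV. v $ l * partial_deriv l f 0) = \<dots>" .
  qed (auto intro!: sum.neutral)
  also have "\<dots> = frechet_derivative f (at 0) v"
    using frechet_eq_sum_partial_deriv[OF f, of 0] by simp
  finally show ?thesis .
qed

text \<open>Where the first factor vanishes, the product rule asks only for continuity of the
  second. It is applied with a component of \<open>F\<close> and a partial derivative of
  \<open>u\<close>, which avoids second derivatives of \<open>u\<close>.\<close>

lemma has_field_derivative_mult_zero:
  fixes a b :: "complex \<Rightarrow> complex"
  assumes "(a has_field_derivative a') (at x)" "a x = 0" "b \<midarrow>x\<rightarrow> b x"
  shows "((\<lambda>s. a s * b s) has_field_derivative a' * b x) (at x)"
proof -
  have "((\<lambda>s. (a s - a x) / (s - x) * b s) \<longlongrightarrow> a' * b x) (at x)"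
    using assms(1,3) unfolding has_field_derivative_iff by (intro tendsto_mult)
  then show ?thesis
    unfolding has_field_derivative_iff using assms(2) by simp
qed

lemma partial_deriv_tendsto_at_0:
  fixes f :: "complex ^ 'n \<Rightarrow> complex"
  assumes f: "holomorphic_scalar f unit_polydisc"
  shows "((\<lambda>z. partial_deriv i f z) \<longlongrightarrow> partial_deriv i f 0) (at 0)"
proof (rule tendstoI)
  fix e :: real assume e: "e > 0"
  obtain d where d: "0 < d" "d < 1"
    "\<And>z v. norm z < d \<Longrightarrow> cmod (frechet_derivative f (at z) v - frechet_derivative f (at 0) v) \<le> e / 2 * norm v"
    using frechet_derivative_continuous_at_0[OF f, of "e / 2"] e by auto
  have "dist (partial_deriv i f z) (partial_deriv i f 0) < e" if "norm z < d" for z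
  proof -
    have "z \<in> unit_polydisc"
      using ball_subset_polydisc[of 1] that d(2) by (force simp: subset_iff)
    then show ?thesis
      using d(3)[OF that, of "axis i 1"] e
      by (simp add: partial_deriv_eq_frechet[OF f] dist_norm)
  qed
  then show "\<forall>\<^sub>F z in at 0. dist (partial_deriv i f z) (partial_deriv i f 0) < e"
    using d(1) by (auto simp: eventually_at dist_norm)
qed

text \<open>Since \<open>F\<close> vanishes at 0, differentiating the product of
  \<open>F z $ i\<close> and the \<open>i\<close>-th partial derivative of \<open>u\<close> leaves
  only the term in which \<open>F\<close> is differentiated.\<close>

lemma partial_deriv_generator_at_0:
  fixes F :: "complex ^ 'n \<Rightarrow> complex ^ 'n"
  assumes F: "holomorphic_vector F unit_polydisc" "F 0 = 0" and u: "holomorphic_scalar u unit_polydisc"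
  shows "partial_deriv k (generator F u) 0
    = (\<Sum>i\<in>UNIV. jacobian_matrix F 0 $ i $ k * partial_deriv i u 0)"
proof -
  let ?l = "\<lambda>s. s *s (axis k 1 :: complex ^ 'n)"
  have line: "?l s \<in> unit_polydisc" if "cmod s < 1" for s
    using that by (auto simp: polydisc_def axis_def)
  have "((\<lambda>s. F (?l s) $ i * partial_deriv i u (?l s)) has_field_derivative
      jacobian_matrix F 0 $ i $ k * partial_deriv i u (?l 0)) (at 0)" for i
  proof (rule has_field_derivative_mult_zero)
    have Fi: "holomorphic_scalar (\<lambda>z. F z $ i) unit_polydisc"
      using F by (simp add: holomorphic_vector_def)
    show "((\<lambda>s. F (?l s) $ i) has_field_derivative jacobian_matrix F 0 $ i $ k) (at 0)"
      using holomorphic_scalar_line_deriv[OF Fi, of 0 0 "axis k 1"]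
      by (simp add: jacobian_matrix_def partial_deriv_eq_frechet[OF Fi])
    show "F (?l 0) $ i = 0"
      using F(2) by simp
    have "filterlim ?l (at 0) (at 0)"
      unfolding filterlim_at
    proof
      have "isCont ?l 0"
        by (rule linear_continuous_at) (rule bounded_linear_vector_scalar_mult)
      then show "?l \<midarrow>0\<rightarrow> 0"
        by (simp add: isCont_def)
      show "\<forall>\<^sub>F s in at 0. ?l s \<in> UNIV \<and> ?l s \<noteq> 0"
        by (auto simp: eventually_at vec_eq_iff axis_def intro!: exI[of _ 1])
    qed
    from filterlim_compose[OF partial_deriv_tendsto_at_0[OF u] this]
    show "(\<lambda>s. partial_deriv i u (?l s)) \<midarrow>0\<rightarrow> partial_deriv i u (?l 0)"
      by simp
  qed
  then have "((\<lambda>s. \<Sum>i\<in>UNIV. F (?l s) $ i * partial_deriv i u (?l s)) has_field_derivative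
      (\<Sum>i\<in>UNIV. jacobian_matrix F 0 $ i $ k * partial_deriv i u (?l 0))) (at 0)"
    by (intro DERIV_sum)
  then have "((\<lambda>s. generator F u (?l s)) has_field_derivative
      (\<Sum>i\<in>UNIV. jacobian_matrix F 0 $ i $ k * partial_deriv i u (?l 0))) (at 0)"
    by (rule has_field_derivative_transform_within_open[of _ _ _ "ball 0 1"])
      (use line in \<open>auto simp: generator_def\<close>)
  then show ?thesis
    unfolding partial_deriv_def[of k] by (simp add: DERIV_imp_deriv)
qed

text \<open>Pairing the image of \<open>u\<close> under the generator with
  \<open>hardy_linear v\<close> gives the differential of \<open>u\<close> at 0 in direction J v,
  with J the Jacobian at 0. For an eigenvector this is \<open>\<mu>\<close> times the pairing with
  \<open>u\<close>, and moving the scalar into the second slot conjugates it.\<close>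

lemma adjoint_eigenfunction_hardy_linear:
  fixes F :: "complex ^ 'n \<Rightarrow> complex ^ 'n"
  assumes F: "holomorphic_vector F unit_polydisc" "continuous_on (unit_polydisc \<union> torus) F" "F 0 = 0"
    and v: "jacobian_matrix F 0 *v v = \<mu> *s v" "v \<noteq> 0"
  shows "adjoint_eigenfunction F (cnj \<mu>) (hardy_linear v)"
proof -
  have adj: "hardy_inner (generator F u) (hardy_linear v) = hardy_inner u (\<lambda>z. cnj \<mu> * hardy_linear v z)"
    if "u \<in> generator_domain F" for u
  proof -
    have u: "holomorphic_scalar u unit_polydisc" and Au: "holomorphic_scalar (generator F u) unit_polydisc"
      using that by (auto simp: generator_domain_def hardy_holomorphic)
    have "hardy_inner (generator F u) (hardy_linear v)
        = (\<Sum>k\<in>UNIV. v $ k * (\<Sum>i\<in>UNIV. jacobian_matrix F 0 $ i $ k * partial_deriv i u 0))"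
      by (simp add: hardy_inner_linear[OF Au] frechet_eq_sum_partial_deriv[OF Au]
          partial_deriv_generator_at_0[OF F(1,3) u])
    also have "\<dots> = (\<Sum>i\<in>UNIV. (jacobian_matrix F 0 *v v) $ i * partial_deriv i u 0)"
      unfolding matrix_vector_mult_def
      by (simp add: sum_distrib_left sum_distrib_right mult_ac) (rule sum.swap)
    also have "\<dots> = frechet_derivative u (at 0) (\<mu> *s v)"
      by (simp add: v(1) frechet_eq_sum_partial_deriv[OF u])
    also have "\<dots> = hardy_inner u (\<lambda>z. cnj \<mu> * hardy_linear v z)"
      by (simp only: hardy_inner_linear[OF u] flip: hardy_linear_scale)
    finally show ?thesis .
  qed
  have mem: "(\<lambda>z. cnj \<mu> * hardy_linear v z) \<in> hardy"
    using hardy_linear_mem[of "\<mu> *s v"] by (simp only: hardy_linear_scale)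
  have "hardy_linear v \<in> generator_adjoint_domain F"
    unfolding generator_adjoint_domain_def adjoint_domain_def
    using hardy_linear_mem mem adj by blast
  moreover have "generator_adjoint F (hardy_linear v) = (\<lambda>z. cnj \<mu> * hardy_linear v z)"
    unfolding generator_adjoint_def
    by (rule adjoint_op_eqI[OF hardy_monomial_generator_domain[OF F(1,2)] mem adj])
  ultimately show ?thesis
    using hardy_linear_nonzero[OF v(2)] by (simp add: adjoint_eigenfunction_def)
qed

subsection \<open>Invariant subspaces of a matrix with simple spectrum\<close>

lemma eigenvalue_family_eigenvector:
  fixes A :: "complex ^ 'n ^ 'n"
  assumes "eigenvalue_family A lam"
  obtains v where "v \<noteq> 0" "A *v v = lam j *s v"
proof -
  have "det (mat (lam j) - A) = 0"
    using assms by (auto simp: eigenvalue_family_def)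
  then have "\<not> invertible (mat (lam j) - A)"
    using invertible_det_nz by blast
  then obtain v where v: "(mat (lam j) - A) *v v = 0" "v \<noteq> 0"
    using invertible_left_inverse matrix_left_invertible_ker by metis
  have "mat (lam j) *v v = lam j *s v"
    by (simp add: vec_eq_iff matrix_vector_mult_def mat_def
        if_distrib[of "\<lambda>x. x * _"] cong: if_cong)
  then have "A *v v = lam j *s v"
    using v(1) by (simp add: matrix_vector_mult_diff_rdistrib)
  then show ?thesis
    using that v(2) by blast
qed

text \<open>Applying \<open>A\<close> and subtracting \<open>lam k\<close> times the vector removes
  the component along \<open>v k\<close> and multiplies each other one by the nonzero number
  \<open>lam i - lam k\<close>. This shortens the sum by one term, and induction applies.\<close>

lemma invariant_subspace_eigen_components:
  fixes A :: "complex ^ 'n ^ 'n"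
  assumes lam: "inj lam" and v: "\<And>j. A *v v j = lam j *s v j"
    and N: "\<And>x y. x \<in> N \<Longrightarrow> y \<in> N \<Longrightarrow> x + y \<in> N" "\<And>c x. x \<in> N \<Longrightarrow> c *s x \<in> N"
      "\<And>x. x \<in> N \<Longrightarrow> A *v x \<in> N" "0 \<in> N"
    and "finite S" "(\<Sum>j\<in>S. c j *s v j) \<in> N" "j \<in> S"
  shows "c j *s v j \<in> N"
  using assms(7-)
proof (induction S arbitrary: c j rule: finite_induct)
  case (insert k S)
  have diff: "x - y \<in> N" if "x \<in> N" "y \<in> N" for x y
    using N(1)[OF that(1) N(2)[OF that(2), of "-1"]] by simp
  let ?x = "\<Sum>j\<in>insert k S. c j *s v j"
  have "A *v ?x = (\<Sum>j\<in>insert k S. (c j * lam j) *s v j)"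
    by (simp add: linear_sum[OF matrix_vector_mul_linear] vector_scalar_commute v del: sum.insert)
  moreover have "lam k *s ?x = (\<Sum>j\<in>insert k S. (c j * lam k) *s v j)"
    by (simp add: vec.scale_sum_right mult.commute del: sum.insert)
  ultimately have "A *v ?x - lam k *s ?x = (\<Sum>j\<in>insert k S. (c j * (lam j - lam k)) *s v j)"
    by (simp add: right_diff_distrib vec.scale_left_diff_distrib sum_subtractf del: sum.insert)
  also have "\<dots> = (\<Sum>j\<in>S. (c j * (lam j - lam k)) *s v j)"
    using insert.hyps by simp
  finally have "(\<Sum>j\<in>S. (c j * (lam j - lam k)) *s v j) \<in> N"
    using diff[OF N(3)[OF insert.prems(1)] N(2)[OF insert.prems(1), of "lam k"]] by (simp only:)
  then have IH: "(c i * (lam i - lam k)) *s v i \<in> N" if "i \<in> S" for i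
    using insert.IH[where c = "\<lambda>j. c j * (lam j - lam k)"] that by simp
  have S: "c i *s v i \<in> N" if "i \<in> S" for i
  proof -
    have "lam i - lam k \<noteq> 0"
      using that insert.hyps lam by (auto dest: injD)
    then show ?thesis
      using N(2)[OF IH[OF that], of "inverse (lam i - lam k)"] by (simp add: mult_ac)
  qed
  have "(\<Sum>j\<in>S. c j *s v j) \<in> N"
    using insert.hyps(1) S
  proof (induction S rule: finite_induct)
    case (insert i T)
    then show ?case
      by (simp add: N(1))
  qed (simp add: N(4))
  then have "c k *s v k \<in> N"
    using diff[OF insert.prems(1)] insert.hyps by fastforce
  then show ?case
    using S insert.prems(2) by auto
qed simp

lemma invariant_subspace_contains_eigenvector:
  fixes A :: "complex ^ 'n ^ 'n"
  assumes A: "eigenvalue_family A lam" and lam: "inj lam"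
    and N: "\<And>x y. x \<in> N \<Longrightarrow> y \<in> N \<Longrightarrow> x + y \<in> N" "\<And>c x. x \<in> N \<Longrightarrow> c *s x \<in> N"
      "\<And>x. x \<in> N \<Longrightarrow> A *v x \<in> N"
    and x: "x \<in> N" "x \<noteq> 0"
  obtains v j where "v \<in> N" "v \<noteq> 0" "A *v v = lam j *s v"
proof -
  have "\<forall>j. \<exists>v. v \<noteq> 0 \<and> A *v v = lam j *s v"
    using eigenvalue_family_eigenvector[OF A] by metis
  then obtain v where v: "\<And>j. v j \<noteq> 0" "\<And>j. A *v v j = lam j *s v j"
    by metis
  \<comment> \<open>The columns are eigenvectors; once \<open>V\<close> is seen to be injective it
    is surjective, and the eigenvectors span the space.\<close>
  define V where "V = (\<chi> i j. v j $ i)"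
  have V: "V *v c = (\<Sum>j\<in>UNIV. (c $ j) *s v j)" for c
    by (simp add: V_def vec_eq_iff matrix_vector_mult_def mult.commute)
  have "c = 0" if "V *v c = 0" for c
  proof -
    \<comment> \<open>Linear independence is the component lemma for the invariant subspace
      \<open>{0}\<close>.\<close>
    have "(c $ j) *s v j \<in> {0}" for j
    proof (rule invariant_subspace_eigen_components[OF lam v(2)])
      show "(\<Sum>j\<in>UNIV. (c $ j) *s v j) \<in> {0}"
        using that V by simp
    qed (auto simp: matrix_vector_mult_0_right)
    then show ?thesis
      using v(1) by (simp add: vec_eq_iff) blast
  qed
  then have "\<exists>B. B ** V = mat 1"
    using matrix_left_invertible_ker by blast
  then have "surj ((*v) V)"
    using matrix_left_right_inverse matrix_right_invertible_surjective by metis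
  then obtain c where c: "x = (\<Sum>j\<in>UNIV. (c $ j) *s v j)"
    using V by (metis surjD)
  obtain j where j: "c $ j \<noteq> 0"
    using x(2) c by force
  have "0 \<in> N"
    using N(2)[OF x(1), of 0] by simp
  then have "(c $ j) *s v j \<in> N"
    using invariant_subspace_eigen_components[OF lam v(2), where N = N and c = "\<lambda>j. c $ j" and S = UNIV] N x(1) c
    by simp
  then have "v j \<in> N"
    using N(2)[of "(c $ j) *s v j" "inverse (c $ j)"] j by simp
  then show ?thesis
    using that v by blast
qed

subsection \<open>Differences of trajectories\<close>

text \<open>The mean value inequality with derivatives taken within \<open>{0..}\<close>, the form
  in which the flow provides them up to time 0.\<close>

lemma norm_increment_le:
  fixes f :: "real \<Rightarrow> 'a :: real_normed_vector"
  assumes "a \<le> b" and "\<And>t. a \<le> t \<Longrightarrow> t \<le> b \<Longrightarrow> (f has_vector_derivative f' t) (at t within {0..})"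
    and "0 \<le> a" "\<And>t. a \<le> t \<Longrightarrow> t \<le> b \<Longrightarrow> norm (f' t) \<le> B"
  shows "norm (f b - f a) \<le> B * (b - a)"
proof -
  have "norm (f b - f a) \<le> B * norm (b - a)"
  proof (rule differentiable_bound[of "{a..b}"])
    fix t assume t: "t \<in> {a..b}"
    have "(f has_vector_derivative f' t) (at t within {a..b})"
      using assms(3) t by (intro has_vector_derivative_within_subset[OF assms(2)]) auto
    then show "(f has_derivative (\<lambda>x. x *\<^sub>R f' t)) (at t within {a..b})"
      by (simp add: has_vector_derivative_def)
    have "norm (f' t) \<le> B"
      using t assms(4) by auto
    moreover have "0 \<le> B"
      using calculation norm_ge_zero order_trans by blast
    ultimately show "onorm (\<lambda>x. x *\<^sub>R f' t) \<le> B"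
      by (intro onorm_bound) (auto simp: mult.commute[of B] intro: mult_left_mono)
  qed (use assms(1) in auto)
  then show ?thesis
    using assms(1) by simp
qed

text \<open>The product of exp (2 L r) and the squared norm is nondecreasing, that with exp (- 2 L
  r) nonincreasing. Squares are used because they are differentiable also where \<open>w\<close>
  vanishes. The second bound yields backward uniqueness: a zero at a later time forces zeros before
  it.\<close>

lemma exponential_bounds:
  fixes w :: "real \<Rightarrow> 'a :: real_inner"
  assumes w: "\<And>t. t \<ge> 0 \<Longrightarrow> (w has_vector_derivative w' t) (at t within {0..})"
    and L: "\<And>t. t \<ge> 0 \<Longrightarrow> norm (w' t) \<le> L * norm (w t)" and st: "0 \<le> s" "s \<le> t"
  shows "norm (w t) \<le> exp (L * (t - s)) * norm (w s)"
    and "norm (w s) \<le> exp (L * (t - s)) * norm (w t)"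
proof -
  define g where "g c r = exp (c * r) * (w r \<bullet> w r)" for c r
  have deriv: "(g c has_derivative (\<lambda>x. x * (exp (c * r) * (c * (w r \<bullet> w r) + 2 * (w r \<bullet> w' r))))) (at r within {s..t})"
    if "s \<le> r" "r \<le> t" for r c
  proof -
    have "(w has_derivative (\<lambda>x. x *\<^sub>R w' r)) (at r within {s..t})"
      using has_vector_derivative_within_subset[OF w] that st
      by (auto simp: has_vector_derivative_def)
    note w = has_derivative_inner[OF this this]
    have "((\<lambda>r. exp (c * r)) has_derivative (\<lambda>x. x * (c * exp (c * r)))) (at r within {s..t})"
      by (auto intro!: derivative_eq_intros)
    from has_derivative_mult[OF this w] show ?thesis
      unfolding g_def
      by (rule has_derivative_eq_rhs) (simp add: fun_eq_iff algebra_simps inner_commute)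
  qed
  have bound: "\<bar>w r \<bullet> w' r\<bar> \<le> L * (w r \<bullet> w r)" if "r \<in> {s..t}" for r
  proof -
    have "\<bar>w r \<bullet> w' r\<bar> \<le> norm (w r) * norm (w' r)"
      by (rule Cauchy_Schwarz_ineq2)
    also have "\<dots> \<le> norm (w r) * (L * norm (w r))"
      using L[of r] that st by (intro mult_left_mono) auto
    finally show ?thesis
      by (simp add: dot_square_norm power2_eq_square mult_ac)
  qed
  have "g (2 * L) s \<le> g (2 * L) t \<and> g (- 2 * L) t \<le> g (- 2 * L) s"
  proof (cases "s = t")
    case False
    then have "s < t"
      using st by simp
    from mvt_simple[OF this deriv[where c = "2 * L"]]
    obtain r where r: "r \<in> {s<..<t}" "g (2 * L) t - g (2 * L) s
        = (t - s) * (exp (2 * L * r) * (2 * L * (w r \<bullet> w r) + 2 * (w r \<bullet> w' r)))"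
      by blast
    have "0 \<le> 2 * L * (w r \<bullet> w r) + 2 * (w r \<bullet> w' r)"
      using bound[of r] r(1) by (simp add: abs_le_iff)
    then have "0 \<le> g (2 * L) t - g (2 * L) s"
      unfolding r(2) using \<open>s < t\<close> by (intro mult_nonneg_nonneg) auto
    moreover
    from mvt_simple[OF \<open>s < t\<close> deriv[where c = "- 2 * L"]]
    obtain q where q: "q \<in> {s<..<t}" "g (- 2 * L) t - g (- 2 * L) s
        = (t - s) * (exp (- 2 * L * q) * (- 2 * L * (w q \<bullet> w q) + 2 * (w q \<bullet> w' q)))"
      by blast
    have "- 2 * L * (w q \<bullet> w q) + 2 * (w q \<bullet> w' q) \<le> 0"
      using bound[of q] q(1) by (simp add: abs_le_iff)
    then have "g (- 2 * L) t - g (- 2 * L) s \<le> 0"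
      unfolding q(2) using \<open>s < t\<close> by (intro mult_nonneg_nonpos) auto
    ultimately show ?thesis
      by linarith
  qed simp
  moreover have "g (2 * L) r = (exp (L * r) * norm (w r))\<^sup>2" "g (- 2 * L) r = (norm (w r) / exp (L * r))\<^sup>2" for r
  proof -
    have "exp (2 * L * r) = (exp (L * r))\<^sup>2"
      by (simp add: power2_eq_square mult_exp_exp)
    moreover have "exp (- 2 * L * r) = 1 / exp (2 * L * r)"
      by (simp add: exp_minus divide_inverse)
    ultimately show "g (2 * L) r = (exp (L * r) * norm (w r))\<^sup>2" "g (- 2 * L) r = (norm (w r) / exp (L * r))\<^sup>2"
      by (simp_all only: g_def dot_square_norm power_mult_distrib power_divide) simp
  qed
  ultimately have "(exp (L * s) * norm (w s))\<^sup>2 \<le> (exp (L * t) * norm (w t))\<^sup>2"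
    and "(norm (w t) / exp (L * t))\<^sup>2 \<le> (norm (w s) / exp (L * s))\<^sup>2"
    by auto
  then have "exp (L * s) * norm (w s) \<le> exp (L * t) * norm (w t)"
    and "norm (w t) / exp (L * t) \<le> norm (w s) / exp (L * s)"
    by (auto intro: power2_le_imp_le)
  moreover have E: "exp (L * (t - s)) = exp (L * t) / exp (L * s)"
    by (simp add: right_diff_distrib exp_diff)
  ultimately show "norm (w t) \<le> exp (L * (t - s)) * norm (w s)"
    and "norm (w s) \<le> exp (L * (t - s)) * norm (w t)"
    unfolding E by (simp_all add: field_simps del: exp_diff)
qed

section \<open>Functionals that are negligible along a difference of trajectories\<close>

text \<open>\<open>bounded_linear\<close> is linearity over the reals; complex homogeneity is
  required in addition so that the common kernel of these functionals is a complex subspace, in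
  which eigenvectors can be sought.\<close>

definition vanishes_along :: "(real \<Rightarrow> complex ^ 'n) \<Rightarrow> (complex ^ 'n \<Rightarrow> complex) \<Rightarrow> bool" where
  "vanishes_along w l \<longleftrightarrow> bounded_linear l \<and> (\<forall>c v. l (c *s v) = c * l v) \<and>
     (\<forall>\<epsilon>>0. \<exists>T\<ge>0. \<forall>t\<ge>T. cmod (l (w t)) \<le> \<epsilon> * norm (w t))"

text \<open>On the window \<open>[t, t + \<delta>]\<close> the increment of \<open>l (w s)\<close> is \<open>\<delta> l (A w t)\<close> up to an error of order
  \<open>\<delta>\<^sup>2 |w t|\<close>, while \<open>l (w s)\<close> itself is at most \<open>\<delta>\<^sup>2 |w t|\<close> up to a constant for large \<open>t\<close>.\<close>
lemma vanishes_along_matrix: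
  fixes w :: "real \<Rightarrow> complex ^ 'n" and A :: "complex ^ 'n ^ 'n"
  assumes w: "\<And>t. t \<ge> 0 \<Longrightarrow> (w has_vector_derivative w' t) (at t within {0..})"
    and L: "\<And>t. t \<ge> 0 \<Longrightarrow> norm (w' t) \<le> L * norm (w t)" "0 \<le> L"
    and asym: "\<And>\<epsilon>. \<epsilon> > 0 \<Longrightarrow> \<exists>T\<ge>0. \<forall>t\<ge>T. norm (w' t - A *v w t) \<le> \<epsilon> * norm (w t)"
    and l: "vanishes_along w l"
  shows "vanishes_along w (\<lambda>v. l (A *v v))"
proof -
  have lin: "bounded_linear l" and hom: "\<And>c v. l (c *s v) = c * l v"
    and null: "\<And>\<epsilon>. \<epsilon> > 0 \<Longrightarrow> \<exists>T\<ge>0. \<forall>t\<ge>T. cmod (l (w t)) \<le> \<epsilon> * norm (w t)"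
    using l by (auto simp: vanishes_along_def)
  interpret l: bounded_linear l
    by (rule lin)
  have linA: "bounded_linear (\<lambda>v. l (A *v v))"
    using bounded_linear_compose[OF lin matrix_vector_mul_bounded_linear[of A]] by (simp add: o_def)
  interpret lA: bounded_linear "\<lambda>v. l (A *v v)"
    by (rule linA)
  obtain B where B: "0 < B" "\<And>v. cmod (l v) \<le> norm v * B"
    using l.pos_bounded by blast
  obtain C where C: "0 < C" "\<And>v. cmod (l (A *v v)) \<le> norm v * C"
    using lA.pos_bounded by blast
  have "\<exists>T\<ge>0. \<forall>t\<ge>T. cmod (l (A *v w t)) \<le> \<epsilon> * norm (w t)" if \<epsilon>: "\<epsilon> > 0" for \<epsilon>
  proof -
    \<comment> \<open>Collects the error: \<open>exp L\<close> bounds the growth of \<open>w\<close>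
      on a window of length at most 1, 2 stems from the values of \<open>l (w s)\<close> at both
      ends, \<open>B\<close> from replacing \<open>w'\<close> by \<open>A *v w\<close>, and
      \<open>C * L\<close> from the motion of \<open>w\<close> during the window.\<close>
    define M where "M = exp L * (2 + B + C * L)"
    have M: "M > 0"
      unfolding M_def using B(1) C(1) L(2) by (intro mult_pos_pos add_pos_nonneg) auto
    define \<delta> where "\<delta> = min 1 (\<epsilon> / M)"
    have \<delta>: "0 < \<delta>" "\<delta> \<le> 1" "M * \<delta> \<le> \<epsilon>"
      using \<epsilon> M by (auto simp: \<delta>_def min_def field_simps)
    \<comment> \<open>The values at the ends get divided by the window length
      \<open>\<delta>\<close>, so they must be of order \<open>\<delta>\<^sup>2\<close> to
      contribute an error of order \<open>\<delta>\<close>.\<close>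
    define \<eta> where "\<eta> = \<delta>\<^sup>2"
    have \<eta>: "\<eta> > 0"
      using \<delta> by (simp add: \<eta>_def)
    obtain T1 T2 where T: "T1 \<ge> 0" "T2 \<ge> 0"
      "\<And>t. t \<ge> T1 \<Longrightarrow> cmod (l (w t)) \<le> \<eta> * norm (w t)"
      "\<And>t. t \<ge> T2 \<Longrightarrow> norm (w' t - A *v w t) \<le> \<eta> * norm (w t)"
      using null[OF \<eta>] asym[OF \<eta>] by blast
    have "cmod (l (A *v w t)) \<le> \<epsilon> * norm (w t)" if t: "t \<ge> max T1 T2" for t
    proof -
      have t0: "t \<ge> 0"
        using t T(1) by simp
      let ?W = "exp L * norm (w t)"
      have W: "norm (w s) \<le> ?W" if "t \<le> s" "s \<le> t + \<delta>" for s
      proof -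
        have "norm (w s) \<le> exp (L * (s - t)) * norm (w t)"
          using exponential_bounds(1)[OF w L(1) t0 that(1)] .
        also have "L * (s - t) \<le> L * 1"
          using that \<delta> L(2) by (intro mult_left_mono) auto
        then have "exp (L * (s - t)) * norm (w t) \<le> ?W"
          by (intro mult_right_mono) auto
        finally show ?thesis .
      qed
      have inc: "norm (w s - w t) \<le> L * ?W * \<delta>" if s: "t \<le> s" "s \<le> t + \<delta>" for s
      proof -
        have "norm (w s - w t) \<le> L * ?W * (s - t)"
        proof (rule norm_increment_le)
          fix r assume r: "t \<le> r" "r \<le> s"
          show "(w has_vector_derivative w' r) (at r within {0..})"
            using r t0 by (intro w) auto
          have "norm (w' r) \<le> L * norm (w r)"
            using r t0 by (intro L) auto
          also have "\<dots> \<le> L * ?W"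
            using r s L(2) by (intro mult_left_mono W) auto
          finally show "norm (w' r) \<le> L * ?W" .
        qed (use s t0 in auto)
        also have "\<dots> \<le> L * ?W * \<delta>"
          using s L(2) by (intro mult_left_mono) auto
        finally show ?thesis .
      qed
      \<comment> \<open>Subtracting the expected linear increment leaves a function whose derivative
        is just the error of the linearization and of freezing \<open>w\<close> at time
        \<open>t\<close>.\<close>
      define q where "q s = l (w s) - (s - t) *\<^sub>R l (A *v w t)" for s
      have "norm (q (t + \<delta>) - q t) \<le> (B * \<eta> * ?W + C * (L * ?W * \<delta>)) * (t + \<delta> - t)"
      proof (rule norm_increment_le)
        fix s assume s: "t \<le> s" "s \<le> t + \<delta>"
        have "((\<lambda>s. l (w s)) has_vector_derivative l (w' s)) (at s within {0..})"
          using s t0 by (intro l.has_vector_derivative w) auto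
        then show "(q has_vector_derivative (l (w' s) - l (A *v w t))) (at s within {0..})"
          unfolding q_def by (auto intro!: derivative_eq_intros)
        have "l (w' s) - l (A *v w t) = l (w' s - A *v w s) + l (A *v (w s - w t))"
          by (simp add: l.diff matrix_vector_mult_diff_distrib)
        also have "norm \<dots> \<le> cmod (l (w' s - A *v w s)) + cmod (l (A *v (w s - w t)))"
          by (rule norm_triangle_ineq)
        also have "cmod (l (w' s - A *v w s)) \<le> B * \<eta> * ?W"
        proof -
          have "cmod (l (w' s - A *v w s)) \<le> norm (w' s - A *v w s) * B"
            by (rule B)
          also have "\<dots> \<le> (\<eta> * norm (w s)) * B"
            using s t B(1) by (intro mult_right_mono T(4)) auto
          also have "\<dots> \<le> (\<eta> * ?W) * B"
            using s \<eta> B(1) by (intro mult_right_mono mult_left_mono W) auto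
          finally show ?thesis
            by (simp add: mult_ac)
        qed
        also have "cmod (l (A *v (w s - w t))) \<le> C * (L * ?W * \<delta>)"
        proof -
          have "cmod (l (A *v (w s - w t))) \<le> norm (w s - w t) * C"
            by (rule C)
          also have "\<dots> \<le> (L * ?W * \<delta>) * C"
            using s C(1) by (intro mult_right_mono inc) auto
          finally show ?thesis
            by (simp add: mult_ac)
        qed
        finally show "norm (l (w' s) - l (A *v w t)) \<le> B * \<eta> * ?W + C * (L * ?W * \<delta>)"
          by simp
      qed (use \<delta> t0 in auto)
      moreover have "q (t + \<delta>) - q t = (l (w (t + \<delta>)) - l (w t)) - \<delta> *\<^sub>R l (A *v w t)"
        by (simp add: q_def)
      ultimately have "\<delta> * cmod (l (A *v w t))
          \<le> cmod (l (w (t + \<delta>))) + cmod (l (w t)) + (B * \<eta> * ?W + C * (L * ?W * \<delta>)) * \<delta>"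
        using norm_triangle_ineq4[of "l (w (t + \<delta>))" "l (w t)"]
          norm_triangle_ineq2[of "\<delta> *\<^sub>R l (A *v w t)" "l (w (t + \<delta>)) - l (w t)"]
          norm_minus_commute[of "\<delta> *\<^sub>R l (A *v w t)" "l (w (t + \<delta>)) - l (w t)"] \<delta>(1)
        by simp
      also have "cmod (l (w (t + \<delta>))) \<le> \<eta> * ?W"
        using T(3)[of "t + \<delta>"] W[of "t + \<delta>"] t \<delta>(1) mult_left_mono[of "norm (w (t + \<delta>))" ?W \<eta>] \<eta>
        by linarith
      also have "cmod (l (w t)) \<le> \<eta> * ?W"
        using T(3)[of t] W[of t] t \<delta>(1) mult_left_mono[of "norm (w t)" ?W \<eta>] \<eta>
        by linarith
      finally have "\<delta> * cmod (l (A *v w t))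
          \<le> \<delta> * (\<delta> * ?W * 2 + B * \<delta>\<^sup>2 * ?W + C * (L * ?W * \<delta>))"
        by (simp add: \<eta>_def power2_eq_square algebra_simps)
      then have "cmod (l (A *v w t)) \<le> \<delta> * ?W * 2 + B * \<delta>\<^sup>2 * ?W + C * (L * ?W * \<delta>)"
        using \<delta>(1) by simp
      also have "B * \<delta>\<^sup>2 * ?W \<le> B * \<delta> * ?W"
        using \<delta> B(1) by (intro mult_right_mono mult_left_mono) (auto simp: power2_eq_square mult_left_le)
      finally have "cmod (l (A *v w t)) \<le> M * \<delta> * norm (w t)"
        by (simp add: M_def algebra_simps)
      also have "\<dots> \<le> \<epsilon> * norm (w t)"
        using \<delta>(3) by (intro mult_right_mono) auto
      finally show ?thesis .
    qed
    then show ?thesis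
      using T(1) by (intro exI[of _ "max T1 T2"]) auto
  qed
  moreover have "l (A *v (c *s v)) = c * l (A *v v)" for c v
    by (simp add: hom vector_scalar_commute)
  ultimately show ?thesis
    using linA by (auto simp: vanishes_along_def)
qed

lemma vanishes_along_eigenvector:
  fixes w :: "real \<Rightarrow> complex ^ 'n" and A :: "complex ^ 'n ^ 'n"
  assumes w: "\<And>t. t \<ge> 0 \<Longrightarrow> (w has_vector_derivative w' t) (at t within {0..})"
    and L: "\<And>t. t \<ge> 0 \<Longrightarrow> norm (w' t) \<le> L * norm (w t)" "0 \<le> L"
    and asym: "\<And>\<epsilon>. \<epsilon> > 0 \<Longrightarrow> \<exists>T\<ge>0. \<forall>t\<ge>T. norm (w' t - A *v w t) \<le> \<epsilon> * norm (w t)"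
    and A: "eigenvalue_family A lam" "inj lam" and nz: "\<And>t. t \<ge> 0 \<Longrightarrow> w t \<noteq> 0"
  obtains v j where "v \<noteq> 0" "A *v v = lam j *s v" "\<And>l. vanishes_along w l \<Longrightarrow> l v = 0"
proof -
  define N where "N = {v. \<forall>l. vanishes_along w l \<longrightarrow> l v = 0}"
  \<comment> \<open>Integer times suffice: any one limit point of the unit directions will do, and
    compactness of the sphere supplies it.\<close>
  define u where "u n = w (real n) /\<^sub>R norm (w (real n))" for n
  have "u n \<in> sphere 0 1" for n
    using nz by (simp add: u_def)
  then obtain x r where x: "x \<in> sphere 0 1" and r: "strict_mono (r :: nat \<Rightarrow> nat)" "(u \<circ> r) \<longlonglongrightarrow> x"
    using compact_sphere[of 0 1] unfolding compact_def by metis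
  have "x \<in> N"
    unfolding N_def
  proof (intro CollectI allI impI)
    fix l :: "complex ^ 'n \<Rightarrow> complex"
    assume l: "vanishes_along w l"
    then have lin: "bounded_linear l"
      by (simp add: vanishes_along_def)
    interpret l: bounded_linear l
      by (rule lin)
    have "(\<lambda>n. l (u n)) \<longlonglongrightarrow> 0"
    proof (rule LIMSEQ_I)
      fix e :: real assume "e > 0"
      then obtain T where T: "T \<ge> 0" "\<And>t. t \<ge> T \<Longrightarrow> cmod (l (w t)) \<le> e / 2 * norm (w t)"
        using l unfolding vanishes_along_def by (meson half_gt_zero)
      obtain n0 where n0: "T \<le> real n0"
        using real_arch_simple by blast
      have "norm (l (u n) - 0) < e" if "n \<ge> n0" for n
      proof -
        have "cmod (l (w (real n))) \<le> e / 2 * norm (w (real n))"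
          using that n0 by (intro T) (meson of_nat_le_iff order_trans)
        moreover have "norm (w (real n)) > 0"
          using nz by simp
        ultimately have "norm (l (u n)) \<le> e / 2"
          by (simp add: u_def l.scaleR field_simps)
        then show ?thesis
          using \<open>e > 0\<close> by simp
      qed
      then show "\<exists>n0. \<forall>n\<ge>n0. norm (l (u n) - 0) < e"
        by blast
    qed
    then have "(\<lambda>n. l (u (r n))) \<longlonglongrightarrow> 0"
      using LIMSEQ_subseq_LIMSEQ[OF _ r(1)] by (fastforce simp: o_def)
    moreover have "(\<lambda>n. l (u (r n))) \<longlonglongrightarrow> l x"
      using l.tendsto[OF r(2)] by (simp add: o_def)
    ultimately show "l x = 0"
      using LIMSEQ_unique by blast
  qed
  moreover have "x \<noteq> 0"
    using x by auto
  \<comment> \<open>Invariance of the functionals under composition with \<open>A\<close> dualizes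
    to invariance of their common kernel.\<close>
  moreover have "A *v y \<in> N" if "y \<in> N" for y
    using that vanishes_along_matrix[OF w L asym] by (auto simp: N_def)
  moreover have "y + z \<in> N" if "y \<in> N" "z \<in> N" for y z
    using that by (auto simp: N_def vanishes_along_def linear_add[OF bounded_linear.linear])
  moreover have "c *s y \<in> N" if "y \<in> N" for y c
    using that by (auto simp: N_def vanishes_along_def)
  ultimately obtain v j where "v \<in> N" "v \<noteq> 0" "A *v v = lam j *s v"
    using invariant_subspace_contains_eigenvector[OF A] by metis
  then show ?thesis
    using that by (auto simp: N_def)
qed

section \<open>Trajectories of the flow with equal outputs\<close>

lemma norm_le_sum_cmod: "norm (v :: complex ^ 'n) \<le> (\<Sum>k\<in>UNIV. cmod (v $ k))"
  unfolding norm_vec_def by (rule L2_set_le_sum) simp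

lemma flow_continuous_on:
  assumes "holomorphic_flow F \<phi>" "z \<in> unit_polydisc"
  shows "continuous_on {0..} (\<lambda>t. \<phi> t z)"
  unfolding continuous_on_eq_continuous_within
proof
  fix t :: real assume "t \<in> {0..}"
  then have "((\<lambda>s. \<phi> s z) has_vector_derivative F (\<phi> t z)) (at t within {0..})"
    using assms by (simp add: holomorphic_flow_def)
  then show "continuous (at t within {0..}) (\<lambda>t. \<phi> t z)"
    by (rule has_vector_derivative_continuous)
qed

lemma flow_tendsto_0:
  assumes "stable_hyperbolic F \<phi> lam" "z \<in> unit_polydisc"
  shows "((\<lambda>t. \<phi> t z) \<longlongrightarrow> 0) at_top"
proof -
  have "z \<in> basin_of_origin \<phi>"
    using assms closure_subset by (auto simp: stable_hyperbolic_def)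
  then show ?thesis
    using assms(2) by (simp add: basin_of_origin_def extended_flow_def)
qed

text \<open>After some time the trajectory stays within 1/2 of the origin, and before it the
  trajectory is a compact subset of the open polydisc. Confinement away from the boundary makes the
  Lipschitz bounds for \<open>F\<close> available.\<close>

lemma flow_in_smaller_polydisc:
  assumes flow: "holomorphic_flow F \<phi>" and hyp: "stable_hyperbolic F \<phi> lam"
    and z: "z \<in> (unit_polydisc :: (complex ^ 'n) set)"
  obtains R where "0 < R" "R < 1" "\<And>t. t \<ge> 0 \<Longrightarrow> \<phi> t z \<in> polydisc R"
proof -
  have "\<forall>\<^sub>F t in at_top. dist (\<phi> t z) 0 < 1/2"
    using flow_tendsto_0[OF hyp z] by (rule tendstoD) simp
  then obtain T where T: "\<And>t. t \<ge> T \<Longrightarrow> norm (\<phi> t z) < 1/2"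
    by (auto simp: eventually_at_top_linorder)
  have "compact ((\<lambda>t. \<phi> t z) ` {0..T})"
    using continuous_on_subset[OF flow_continuous_on[OF flow z]]
    by (intro compact_continuous_image) auto
  moreover have "(\<lambda>t. \<phi> t z) ` {0..T} \<subseteq> unit_polydisc"
    using flow z by (auto simp: holomorphic_flow_def)
  ultimately obtain R where R: "0 < R" "R < 1" "(\<lambda>t. \<phi> t z) ` {0..T} \<subseteq> polydisc R"
    by (rule compact_subset_unit_polydisc)
  show ?thesis
  proof (rule that[of "max R (1/2)"])
    fix t :: real assume t: "t \<ge> 0"
    show "\<phi> t z \<in> polydisc (max R (1/2))"
    proof (cases "t \<le> T")
      case True
      then have "\<phi> t z \<in> polydisc R"
        using t R(3) by auto
      then show ?thesis
        using polydisc_mono[of R "max R (1/2)"] by auto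
    next
      case False
      then have "\<phi> t z \<in> polydisc (1/2)"
        using T[of t] ball_subset_polydisc[of "1/2"] by (force simp: subset_iff)
      then show ?thesis
        using polydisc_mono[of "1/2" "max R (1/2)"] by auto
    qed
  qed (use R in auto)
qed

text \<open>The dynamical core, free of the Hardy space: \<open>obs\<close> is what the condition on
  principal eigenfunctions becomes once the pairing with a linear form is rewritten as a
  differential at 0.\<close>

lemma observable_trajectories:
  fixes F :: "complex ^ 'n \<Rightarrow> complex ^ 'n" and h :: "complex ^ 'n \<Rightarrow> complex ^ 'm"
  assumes flow: "holomorphic_flow F \<phi>" and hyp: "stable_hyperbolic F \<phi> lam"
    and h: "\<And>i. holomorphic_scalar (\<lambda>z. h z $ i) unit_polydisc"
    and obs: "\<And>j v. v \<noteq> 0 \<Longrightarrow> jacobian_matrix F 0 *v v = lam j *s v \<Longrightarrow>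
      \<exists>i. frechet_derivative (\<lambda>z. h z $ i) (at 0) v \<noteq> 0"
    and z: "z \<in> unit_polydisc" "z' \<in> unit_polydisc"
    and out: "\<And>t. t \<ge> 0 \<Longrightarrow> h (\<phi> t z) = h (\<phi> t z')"
  shows "z = z'"
proof (rule ccontr)
  assume "z \<noteq> z'"
  define x where "x t = \<phi> t z" for t
  define y where "y t = \<phi> t z'" for t
  define w where "w t = x t - y t" for t
  define w' where "w' t = F (x t) - F (y t)" for t
  have F: "holomorphic_scalar (\<lambda>z. F z $ i) unit_polydisc" for i
    using flow by (simp add: holomorphic_flow_def holomorphic_vector_def)
  have w: "(w has_vector_derivative w' t) (at t within {0..})" if "t \<ge> 0" for t
    unfolding w_def w'_def x_def y_def
    using flow z that by (intro has_vector_derivative_diff) (auto simp: holomorphic_flow_def)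
  obtain R1 where R1: "0 < R1" "R1 < 1" "\<And>t. t \<ge> 0 \<Longrightarrow> x t \<in> polydisc R1"
    unfolding x_def using flow_in_smaller_polydisc[OF flow hyp z(1)] by blast
  obtain R2 where R2: "0 < R2" "R2 < 1" "\<And>t. t \<ge> 0 \<Longrightarrow> y t \<in> polydisc R2"
    unfolding y_def using flow_in_smaller_polydisc[OF flow hyp z(2)] by blast
  define R where "R = max R1 R2"
  have R: "0 < R" "R < 1"
    using R1 R2 by (auto simp: R_def)
  have xy: "x t \<in> polydisc R" "y t \<in> polydisc R" if "t \<ge> 0" for t
    using R1(3)[OF that] R2(3)[OF that] polydisc_mono[of R1 R] polydisc_mono[of R2 R]
    by (auto simp: R_def)
  have "\<forall>i. \<exists>L\<ge>0. \<forall>x\<in>polydisc R. \<forall>y\<in>polydisc R. cmod (F x $ i - F y $ i) \<le> L * norm (x - y)"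
    using holomorphic_scalar_lipschitz[OF F R] by metis
  then obtain L where L: "\<And>i. L i \<ge> 0"
    "\<And>i x y. x \<in> polydisc R \<Longrightarrow> y \<in> polydisc R \<Longrightarrow> cmod (F x $ i - F y $ i) \<le> L i * norm (x - y)"
    by metis
  have lip: "norm (w' t) \<le> (\<Sum>i\<in>UNIV. L i) * norm (w t)" if "t \<ge> 0" for t
  proof -
    have "norm (w' t) \<le> (\<Sum>i\<in>UNIV. cmod (w' t $ i))"
      by (rule norm_le_sum_cmod)
    also have "\<dots> \<le> (\<Sum>i\<in>UNIV. L i * norm (w t))"
      using L(2)[OF xy[OF that]] by (intro sum_mono) (simp add: w'_def w_def)
    finally show ?thesis
      by (simp add: sum_distrib_right)
  qed
  have L0: "0 \<le> (\<Sum>i\<in>UNIV. L i)"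
    using L(1) by (simp add: sum_nonneg)
  have nz: "w t \<noteq> 0" if "t \<ge> 0" for t
  proof
    assume "w t = 0"
    then have "w 0 = 0"
      using exponential_bounds(2)[OF w lip order_refl that] by simp
    then show False
      using \<open>z \<noteq> z'\<close> flow z by (simp add: w_def x_def y_def holomorphic_flow_def)
  qed
  have near: "\<exists>T\<ge>0. \<forall>t\<ge>T. norm (x t) < d \<and> norm (y t) < d" if "d > 0" for d
  proof -
    have "\<forall>\<^sub>F t in at_top. dist (x t) 0 < d \<and> dist (y t) 0 < d"
      unfolding x_def y_def using flow_tendsto_0[OF hyp] z that
      by (intro eventually_conj tendstoD) auto
    then obtain T where "\<And>t. t \<ge> T \<Longrightarrow> norm (x t) < d \<and> norm (y t) < d"
      by (auto simp: eventually_at_top_linorder)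
    then show ?thesis
      by (intro exI[of _ "max 0 T"]) auto
  qed
  have linearize: "\<exists>T\<ge>0. \<forall>t\<ge>T. cmod (f (x t) - f (y t) - frechet_derivative f (at 0) (w t)) \<le> \<epsilon> * norm (w t)"
    if f: "holomorphic_scalar f unit_polydisc" and \<epsilon>: "\<epsilon> > 0" for f \<epsilon>
  proof -
    obtain d where "0 < d" and d: "\<And>x y. norm x < d \<Longrightarrow> norm y < d \<Longrightarrow>
        cmod (f x - f y - frechet_derivative f (at 0) (x - y)) \<le> \<epsilon> * norm (x - y)"
      using holomorphic_scalar_strictly_differentiable[OF f \<epsilon>] by metis
    from near[OF \<open>0 < d\<close>] show ?thesis
      unfolding w_def using d by meson
  qed
  have asym: "\<exists>T\<ge>0. \<forall>t\<ge>T. norm (w' t - jacobian_matrix F 0 *v w t) \<le> \<epsilon> * norm (w t)" if "\<epsilon> > 0" for \<epsilon>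
  proof -
    \<comment> \<open>The norm is bounded by the sum of the coordinate moduli, so each coordinate
      gets an equal share of \<open>\<epsilon>\<close>.\<close>
    define e where "e = \<epsilon> / CARD('n)"
    have e: "e > 0"
      using that by (simp add: e_def)
    have J: "(jacobian_matrix F 0 *v v) $ i = frechet_derivative (\<lambda>z. F z $ i) (at 0) v" for v i
      by (simp add: frechet_eq_sum_partial_deriv[OF F] matrix_vector_mult_def jacobian_matrix_def mult.commute)
    have "\<forall>i. \<exists>T\<ge>0. \<forall>t\<ge>T. cmod ((w' t - jacobian_matrix F 0 *v w t) $ i) \<le> e * norm (w t)"
      using linearize[OF F e] by (simp add: J w'_def)
    then obtain T where T: "\<And>i. T i \<ge> 0"
      "\<And>i t. t \<ge> T i \<Longrightarrow> cmod ((w' t - jacobian_matrix F 0 *v w t) $ i) \<le> e * norm (w t)"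
      by metis
    \<comment> \<open>The sum of the nonnegative thresholds dominates each of them.\<close>
    have "norm (w' t - jacobian_matrix F 0 *v w t) \<le> \<epsilon> * norm (w t)" if t: "t \<ge> (\<Sum>i\<in>UNIV. T i)" for t
    proof -
      have "t \<ge> T i" for i
        using t member_le_sum[of i UNIV T] T(1) by auto
      then have "(\<Sum>i\<in>UNIV. cmod ((w' t - jacobian_matrix F 0 *v w t) $ i)) \<le> (\<Sum>i\<in>(UNIV :: 'n set). e * norm (w t))"
        by (intro sum_mono T(2))
      then show ?thesis
        using norm_le_sum_cmod[of "w' t - jacobian_matrix F 0 *v w t"] by (simp add: e_def)
    qed
    then show ?thesis
      using T(1) by (intro exI[of _ "\<Sum>i\<in>UNIV. T i"]) (auto intro: sum_nonneg)
  qed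
  have "vanishes_along w (frechet_derivative (\<lambda>z. h z $ i) (at 0))" for i
    unfolding vanishes_along_def
  proof (intro conjI allI impI)
    note D = holomorphic_scalar_frechet[OF h, of 0]
    show "bounded_linear (frechet_derivative (\<lambda>z. h z $ i) (at 0))"
      using has_derivative_bounded_linear[OF D(1)] by simp
    show "frechet_derivative (\<lambda>z. h z $ i) (at 0) (c *s v) = c * frechet_derivative (\<lambda>z. h z $ i) (at 0) v" for c v
      using D(2) by simp
    show "\<exists>T\<ge>0. \<forall>t\<ge>T. cmod (frechet_derivative (\<lambda>z. h z $ i) (at 0) (w t)) \<le> \<epsilon> * norm (w t)" if \<epsilon>: "\<epsilon> > 0" for \<epsilon>
    proof -
      obtain T where T: "T \<ge> 0" "\<And>t. t \<ge> T \<Longrightarrow>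
          cmod (h (x t) $ i - h (y t) $ i - frechet_derivative (\<lambda>z. h z $ i) (at 0) (w t)) \<le> \<epsilon> * norm (w t)"
        using linearize[OF h \<epsilon>] by blast
      \<comment> \<open>With equal outputs, the linearization error is the differential itself,
        which is therefore negligible.\<close>
      have "h (x t) = h (y t)" if "t \<ge> T" for t
        using out[of t] that T(1) by (simp add: x_def y_def)
      then show ?thesis
        using T by (intro exI[of _ T]) auto
    qed
  qed
  moreover obtain v j where "v \<noteq> 0" "jacobian_matrix F 0 *v v = lam j *s v"
    "\<And>l. vanishes_along w l \<Longrightarrow> l v = 0"
    using vanishes_along_eigenvector[OF w lip L0 asym _ _ nz] hyp
    unfolding stable_hyperbolic_def by metis
  ultimately show False
    using obs by blast
qed

section \<open>From almost everywhere vanishing outputs to equal outputs at all times\<close>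

text \<open>A nonzero value at \<open>t\<close> persists on an interval of positive length. The
  interval is taken to the right of \<open>t\<close>, so that it stays in the domain also for
  \<open>t = 0\<close>.\<close>

lemma continuous_AE_zero_imp_zero:
  fixes g :: "real \<Rightarrow> 'a :: real_normed_vector"
  assumes g: "continuous_on {0..} g" and AE: "\<And>\<tau>. \<tau> > 0 \<Longrightarrow> AE t in lebesgue_on {0..\<tau>}. g t = 0"
    and t: "t \<ge> 0"
  shows "g t = 0"
proof (rule ccontr)
  assume nz: "g t \<noteq> 0"
  obtain d where d: "d > 0" "\<And>s. s \<ge> 0 \<Longrightarrow> dist s t < d \<Longrightarrow> dist (g s) (g t) < norm (g t)"
    using g nz t unfolding continuous_on_iff by (metis atLeast_iff zero_less_norm_iff)
  have nz': "g s \<noteq> 0" if "t \<le> s" "s \<le> t + d / 2" for s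
    using d(2)[of s] that d(1) t by (auto simp: dist_norm)
  have "AE s in lebesgue_on {0..t + d / 2}. g s = 0"
    using t d(1) by (intro AE) simp
  then have "AE s in lebesgue. s \<in> {0..t + d / 2} \<longrightarrow> g s = 0"
    by (simp add: AE_restrict_space_iff)
  then have "AE s in lebesgue. s \<notin> {t..t + d / 2}"
    by (rule eventually_mono) (use nz' t in auto)
  then have "{t..t + d / 2} \<in> null_sets lebesgue"
    by (subst AE_iff_null_sets) auto
  then show False
    using d(1) by (auto simp: null_sets_def)
qed

text \<open>The conjugate arises because \<open>output_op\<close> pairs the state in the first slot
  with the output function in the second, opposite to the order in the reproducing property.\<close>

lemma observation_map_kernel_diff:
  fixes F :: "complex ^ 'n \<Rightarrow> complex ^ 'n" and h :: "complex ^ 'n \<Rightarrow> complex ^ 'm"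
  assumes flow: "holomorphic_flow F \<phi>" and h: "\<And>i. holomorphic_scalar (\<lambda>z. h z $ i) unit_polydisc"
    and z: "z \<in> unit_polydisc" "z' \<in> unit_polydisc" and t: "t \<ge> 0"
  shows "observation_map \<phi> h (kernel_diff z z') t $ i = cnj (h (\<phi> t z) $ i - h (\<phi> t z') $ i)"
proof -
  have "\<phi> t z \<in> unit_polydisc" "\<phi> t z' \<in> unit_polydisc"
    using flow t z by (auto simp: holomorphic_flow_def)
  then have "hardy_inner (\<lambda>z. h z $ i) (kernel_diff (\<phi> t z) (\<phi> t z')) = h (\<phi> t z) $ i - h (\<phi> t z') $ i"
    by (rule hardy_inner_kernel_diff[OF h])
  from arg_cong[OF this, of cnj] show ?thesis
    unfolding observation_map_def output_op_def koopman_adjoint_kernel_diff[OF flow t z]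
    by (simp add: cnj_hardy_inner)
qed

theorem theorem19:
  fixes F :: "complex ^ 'n \<Rightarrow> complex ^ 'n"
    and \<phi> :: "real \<Rightarrow> complex ^ 'n \<Rightarrow> complex ^ 'n"
    and lam :: "'n \<Rightarrow> complex"
    and h :: "complex ^ 'n \<Rightarrow> complex ^ 'm"
  assumes "holomorphic_flow F \<phi>"
    and "forward_invariant \<phi>"
    and "stable_hyperbolic F \<phi> lam"
    and "non_resonant lam"
    and "\<forall>i. (\<lambda>z. h z $ i) \<in> hardy"
    and "\<forall>j \<psi>. adjoint_eigenfunction F (cnj (lam j)) \<psi> \<longrightarrow>
           (\<exists>i. hardy_inner (\<lambda>z. h z $ i) \<psi> \<noteq> 0)"
  shows "pointwise_approx_observable \<phi> h"
  unfolding pointwise_approx_observable_def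
proof (intro equalityI subsetI)
  note flow = assms(1)
  have h: "holomorphic_scalar (\<lambda>z. h z $ i) unit_polydisc" for i
    using assms(5) hardy_holomorphic by blast
  \<comment> \<open>The zero function counts as a kernel difference through equal base points; any
    common base point would do.\<close>
  have zero: "kernel_diff 0 0 = (\<lambda>w :: complex ^ 'n. 0)"
    by (simp add: kernel_diff_def fun_eq_iff)
  {
    fix f :: "complex ^ 'n \<Rightarrow> complex" assume "f \<in> {\<lambda>z. 0}"
    then have f: "f = kernel_diff 0 0"
      by (simp add: zero)
    have "f \<in> hardy"
      unfolding f by (rule kernel_diff_mem) auto
    moreover have "f \<in> kernel_differences"
      unfolding kernel_differences_def f kernel_diff_def by (intro CollectI exI[of _ 0]) auto
    moreover have "observation_map \<phi> h f t = 0" if "t \<ge> 0" for t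
      unfolding f using observation_map_kernel_diff[OF flow h _ _ that, of 0 0] by (simp add: vec_eq_iff)
    then have "AE t in lebesgue_on {0..\<tau>}. observation_map \<phi> h f t = 0" for \<tau>
      by (intro AE_I2) auto
    ultimately show "f \<in> (\<Inter>\<tau>\<in>{0<..}. observation_kernel \<phi> h \<tau> \<inter> kernel_differences)"
      by (simp add: observation_kernel_def)
  next
    fix f assume f: "f \<in> (\<Inter>\<tau>\<in>{0<..}. observation_kernel \<phi> h \<tau> \<inter> kernel_differences)"
    \<comment> \<open>Some positive \<open>\<tau>\<close> exists, so membership in the intersection
      can be read off from one of its members.\<close>
    then have "f \<in> kernel_differences"
      by (auto intro: gt_ex)
    then obtain z z' where z: "z \<in> unit_polydisc" "z' \<in> unit_polydisc" and fz: "f = kernel_diff z z'"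
      by (auto simp: kernel_differences_def kernel_diff_def fun_eq_iff)
    have out: "h (\<phi> t z) $ i - h (\<phi> t z') $ i = 0" if "t \<ge> 0" for t i
    proof (rule continuous_AE_zero_imp_zero[OF _ _ that])
      have "continuous_on {0..} (\<lambda>t. h (\<phi> t u) $ i)" if "u \<in> unit_polydisc" for u
        by (rule continuous_on_compose2[OF holomorphic_scalar_imp_continuous_on[OF h] flow_continuous_on[OF flow that]])
          (use flow that in \<open>auto simp: holomorphic_flow_def\<close>)
      then show "continuous_on {0..} (\<lambda>t. h (\<phi> t z) $ i - h (\<phi> t z') $ i)"
        using z by (intro continuous_on_diff)
      fix \<tau> :: real assume "\<tau> > 0"
      then have "AE t in lebesgue_on {0..\<tau>}. observation_map \<phi> h f t = 0"
        using f by (auto simp: observation_kernel_def)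
      \<comment> \<open>The formula for the observation map is valid for nonnegative times, a fact
        recovered from the underlying space of the restricted measure.\<close>
      then have "AE t in lebesgue_on {0..\<tau>}. t \<in> space (lebesgue_on {0..\<tau>}) \<and> observation_map \<phi> h f t = 0"
        by (intro AE_conjI AE_space)
      then show "AE t in lebesgue_on {0..\<tau>}. h (\<phi> t z) $ i - h (\<phi> t z') $ i = 0"
      proof (rule eventually_mono)
        fix t assume t: "t \<in> space (lebesgue_on {0..\<tau>}) \<and> observation_map \<phi> h f t = 0"
        then have "cnj (h (\<phi> t z) $ i - h (\<phi> t z') $ i) = 0"
          using observation_map_kernel_diff[OF flow h z, of t i] by (simp add: fz)
        then show "h (\<phi> t z) $ i - h (\<phi> t z') $ i = 0"
          by (simp only: complex_cnj_zero_iff)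
      qed
    qed
    have "z = z'"
    proof (rule observable_trajectories[OF flow assms(3) h _ z])
      fix j v assume v: "v \<noteq> 0" "jacobian_matrix F 0 *v v = lam j *s v"
      have "F 0 = 0"
        using assms(3) by (simp add: stable_hyperbolic_def stable_equilibrium_origin_def)
      then have "adjoint_eigenfunction F (cnj (lam j)) (hardy_linear v)"
        using flow v by (intro adjoint_eigenfunction_hardy_linear) (auto simp: holomorphic_flow_def)
      then obtain i where "hardy_inner (\<lambda>z. h z $ i) (hardy_linear v) \<noteq> 0"
        using assms(6) by blast
      then show "\<exists>i. frechet_derivative (\<lambda>z. h z $ i) (at 0) v \<noteq> 0"
        using hardy_inner_linear[OF h] by metis
    next
      show "h (\<phi> t z) = h (\<phi> t z')" if "t \<ge> 0" for t
        using out[OF that] by (simp add: vec_eq_iff)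
    qed
    then show "f \<in> {\<lambda>z. 0}"
      by (simp add: fz kernel_diff_def fun_eq_iff)
  }
qed

end
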